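(* Let $m\in\mathbb{N}_0$, let $\alpha,\beta>-1$ be such that if $\alpha,\beta\in(-1,0)$ then $\alpha+\beta+1\neq 0$, let $x\in[-1,1]$ and $\rho\in\mathbf{D}\setminus(-1,0]$. Then $$\frac{(1+x)^{-\beta/2}}{R^{\alpha+m+1}}\,P_{\alpha+m}^{-\beta}(\zeta_+)=\sum_{n=0}^\infty a_{n,m}^{(\alpha,\beta)}(\rho)\,P_n^{(\alpha,\beta)}(x),$$ where $R=\sqrt{1+\rho^2-2\rho x}$, $\zeta_+=(1+\rho)/R$, and $a_{n,m}^{(\alpha,\beta)}:\mathbf{D}\setminus(-1,0]\to\mathbb{C}$ is defined by $$a_{n,m}^{(\alpha,\beta)}(\rho):=\frac{(2n+\alpha+\beta+1)\,\Gamma(\alpha+\beta+n+1)\,(\alpha+\beta+m+1)_{2n}}{2^{\beta/2}\,\Gamma(\beta+n+1)}\cdot\frac{1}{\rho^{(\alpha+1)/2}(1-\rho)^m}\,P_{-m}^{-\alpha-\beta-2n-1}\!\left(\frac{1+\rho}{1-\rho}\right).$$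
   Context: $\mathbb{N}_0=\{0,1,2,\dots\}$, $\mathbf{D}=\{z\in\mathbb{C}:|z|<1\}$. $(z)_n=\prod_{i=1}^n(z+i-1)$ is the Pochhammer symbol. ${}_2F_1(a,b;c;z)=\sum_{n\ge0}\frac{(a)_n(b)_n}{(c)_n}\frac{z^n}{n!}$ is the Gauss hypergeometric function, analytically continued to $\mathbb{C}\setminus[1,\infty)$. The Jacobi polynomials are $P_n^{(\alpha,\beta)}(z)=\frac{(\alpha+1)_n}{n!}\,{}_2F_1(-n,n+\alpha+\beta+1;\alpha+1;\frac{1-z}{2})$. The associated Legendre function of the first kind $P_\nu^\mu:\mathbb{C}\setminus(-\infty,1]\to\mathbb{C}$ is $$P_\nu^\mu(z)=\frac{1}{\Gamma(1-\mu)}\left(\frac{z+1}{z-1}\right)^{\mu/2}{}_2F_1\!\left(-\nu,\nu+1;1-\mu;\frac{1-z}{2}\right).$$ All powers and square roots are principal. At $x=-1$ (where $\zeta_+=1$) the left-hand side is understood as its limit as $x\to-1^+$. *)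

theory Defs
  imports "HOL-Complex_Analysis.Complex_Analysis"
begin

definition slit_plane :: "complex set" where
  "slit_plane = - (complex_of_real ` {1..})"

definition gauss_series :: "complex \<Rightarrow> complex \<Rightarrow> complex \<Rightarrow> complex \<Rightarrow> complex" where
  "gauss_series a b c z = eval_fps (fps_hypergeo [a, b] [c] 1) z"

(* On the slit plane this is the analytic continuation of the series from the unit disc; it is
   unique by the identity theorem (gauss_2F1_eqI).  On the cut, where there is no continuation in
   general, the series itself is kept, so that a terminating series gives its polynomial on the
   whole plane (gauss_2F1_terminating). *)
definition gauss_2F1 :: "complex \<Rightarrow> complex \<Rightarrow> complex \<Rightarrow> complex \<Rightarrow> complex" where
  "gauss_2F1 a b c z =
     (if z \<in> slit_plane
      then (SOME f. f holomorphic_on slit_plane \<and> (\<forall>w\<in>ball 0 1. f w = gauss_series a b c w)) z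
      else gauss_series a b c z)"

definition jacobi_P :: "nat \<Rightarrow> complex \<Rightarrow> complex \<Rightarrow> complex \<Rightarrow> complex" where
  "jacobi_P n \<alpha> \<beta> z =
     pochhammer (\<alpha> + 1) n / fact n *
     gauss_2F1 (- of_nat n) (of_nat n + \<alpha> + \<beta> + 1) (\<alpha> + 1) ((1 - z) / 2)"

(* Only meaningful off the cut (-\<infinity>, 1].  The argument order is degree \<nu>, order \<mu>. *)
definition legendre_P :: "complex \<Rightarrow> complex \<Rightarrow> complex \<Rightarrow> complex" where
  "legendre_P \<nu> \<mu> z =
     1 / Gamma (1 - \<mu>) * ((z + 1) / (z - 1)) powr (\<mu> / 2) *
     gauss_2F1 (- \<nu>) (\<nu> + 1) (1 - \<mu>) ((1 - z) / 2)"

definition R_fun :: "complex \<Rightarrow> real \<Rightarrow> complex" where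
  "R_fun \<rho> x = csqrt (1 + \<rho>\<^sup>2 - 2 * \<rho> * of_real x)"

definition zeta_plus :: "complex \<Rightarrow> real \<Rightarrow> complex" where
  "zeta_plus \<rho> x = (1 + \<rho>) / R_fun \<rho> x"

(* Not meaningful at x = -1, where (1 + x) powr (-\<beta>/2) degenerates and zeta_plus lies on the cut
   of the Legendre function; there only the limit from the right is to be used. *)
definition gen_fun :: "real \<Rightarrow> real \<Rightarrow> nat \<Rightarrow> complex \<Rightarrow> real \<Rightarrow> complex" where
  "gen_fun \<alpha> \<beta> m \<rho> x =
     of_real ((1 + x) powr (- \<beta> / 2)) / R_fun \<rho> x powr of_real (\<alpha> + of_nat m + 1) *
     legendre_P (of_real (\<alpha> + of_nat m)) (of_real (- \<beta>)) (zeta_plus \<rho> x)"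

definition coeff_a :: "real \<Rightarrow> real \<Rightarrow> nat \<Rightarrow> nat \<Rightarrow> complex \<Rightarrow> complex" where
  "coeff_a \<alpha> \<beta> n m \<rho> =
     of_real ((2 * of_nat n + \<alpha> + \<beta> + 1) * Gamma (\<alpha> + \<beta> + of_nat n + 1) *
              pochhammer (\<alpha> + \<beta> + of_nat m + 1) (2 * n) /
              (2 powr (\<beta> / 2) * Gamma (\<beta> + of_nat n + 1))) *
     (1 / (\<rho> powr of_real ((\<alpha> + 1) / 2) * (1 - \<rho>) ^ m)) *
     legendre_P (- of_nat m) (of_real (- \<alpha> - \<beta> - 2 * of_nat n - 1)) ((1 + \<rho>) / (1 - \<rho>))"

lemma gauss_series_altdef:
  "gauss_series a b c z =
     (\<Sum>n. pochhammer a n * pochhammer b n / pochhammer c n * z ^ n / fact n)"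
  by (simp add: gauss_series_def eval_fps_def)

lemma open_slit_plane: "open slit_plane"
proof -
  have "complex_of_real ` {1..} = {z. Re z \<ge> 1} \<inter> {z. Im z = 0}"
    by (auto simp: complex_eq_iff intro!: image_eqI[where x = "Re _"])
  moreover have "closed ({z. Re z \<ge> 1} \<inter> {z. Im z = 0})"
    by (intro closed_Int closed_halfspace_Re_ge closed_Collect_eq continuous_intros)
  ultimately show ?thesis
    by (simp add: slit_plane_def closed_def)
qed

lemma starlike_slit_plane: "starlike slit_plane"
proof -
  have "closed_segment 0 z \<subseteq> slit_plane" if z: "z \<in> slit_plane" for z
  proof
    fix w assume "w \<in> closed_segment 0 z"
    then obtain u where u: "0 \<le> u" "u \<le> 1" "w = of_real u * z"
      by (auto simp: closed_segment_def scaleR_conv_of_real)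
    show "w \<in> slit_plane"
    proof (rule ccontr)
      assume "w \<notin> slit_plane"
      then obtain t where t: "t \<ge> 1" "w = of_real t"
        by (auto simp: slit_plane_def)
      with u have "u > 0" by (cases "u = 0") auto
      with t u have "z = of_real (t / u)" "t / u \<ge> 1"
        by (auto simp: field_simps)
      with z show False unfolding slit_plane_def by (metis ComplD atLeast_iff imageI)
    qed
  qed
  moreover have "0 \<in> slit_plane" by (auto simp: slit_plane_def)
  ultimately show ?thesis by (auto simp: starlike_def)
qed

lemma ball_subset_slit_plane: "ball 0 1 \<subseteq> slit_plane"
  by (auto simp: slit_plane_def)

lemma gauss_2F1_eqI:
  assumes f: "f holomorphic_on slit_plane"
    and eq: "\<And>w. norm w < 1 \<Longrightarrow> f w = gauss_series a b c w"
    and z: "z \<in> slit_plane"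
  shows "gauss_2F1 a b c z = f z"
proof -
  define P where
    "P = (\<lambda>f. f holomorphic_on slit_plane \<and> (\<forall>w\<in>ball 0 1. f w = gauss_series a b c w))"
  define g where "g = Eps P"
  have "P f" using f eq by (auto simp: P_def)
  then have g: "P g" unfolding g_def using someI[of P f] by simp
  have "g z = f z"
  proof (rule analytic_continuation_open[of "ball 0 1" slit_plane g f])
    show "connected slit_plane"
      by (rule starlike_imp_connected[OF starlike_slit_plane])
  qed (use f g eq z open_slit_plane ball_subset_slit_plane in \<open>auto simp: P_def\<close>)
  then show ?thesis
    using z by (simp add: gauss_2F1_def g_def P_def)
qed

lemma gauss_2F1_terminating:
  "gauss_2F1 (- of_nat n) b c z =
     (\<Sum>k\<le>n. pochhammer (- of_nat n) k * pochhammer b k / pochhammer c k * z ^ k / fact k)"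
proof -
  define p where
    "p = (\<lambda>z. \<Sum>k\<le>n. pochhammer (- of_nat n :: complex) k * pochhammer b k / pochhammer c k * z ^ k / fact k)"
  have ser: "gauss_series (- of_nat n) b c w = p w" for w
    unfolding gauss_series_altdef p_def
    by (rule suminf_finite) (auto simp: pochhammer_of_nat_eq_0_lemma)
  have "p holomorphic_on slit_plane"
    unfolding p_def by (intro holomorphic_intros) auto
  then have "gauss_2F1 (- of_nat n) b c z = p z"
    using gauss_2F1_eqI[of p "- of_nat n" b c z] ser by (cases "z \<in> slit_plane") (auto simp: gauss_2F1_def)
  then show ?thesis by (simp add: p_def)
qed

end

theory Submission
  imports Defs
begin

text \<open>Write \<open>a = \<alpha> + \<beta> + 1\<close>, \<open>c = \<beta> + 1\<close>, \<open>\<nu> = \<alpha> + m\<close>, \<open>lam = a + m = \<nu> + c\<close>, \<open>t = (1 + x) / 2\<close>,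
\<open>R = R_fun \<rho> x\<close> and \<open>q = 1 + \<rho> + R\<close>. Both sides of the identity contain the factor
\<open>\<rho>\<^bsup>\<beta>/2\<^esup> / (2\<^bsup>\<beta>/2\<^esup> \<Gamma>(c))\<close>. What is left after removing it is holomorphic in the whole unit disc, so
the theorem becomes an identity between two power series in \<open>\<rho>\<close>.

On the left, \<open>q * (1 + \<rho> - R) = 4 * \<rho> * t\<close> gives \<open>(\<zeta> + 1) / (\<zeta> - 1) = q\<^sup>2 / (4 * \<rho> * t)\<close>, and what is left is
\<open>(2 / q)\<^bsup>\<beta>\<^esup> R\<^bsup>-\<nu>-1\<^esup> F(-\<nu>, \<nu> + 1; c; (1 - \<zeta>) / 2)\<close>. Pfaff's transformation and the quadratic
transformation in \<open>w = (1 + \<rho> - R) / q\<close>, which satisfies \<open>w / (1 + w)\<^sup>2 = \<rho> * t / (1 + \<rho>)\<^sup>2\<close>, show that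
near \<open>\<rho> = 0\<close> this is \<open>(1 + \<rho>)\<^bsup>-lam\<^esup> F(lam / 2, (lam + 1) / 2; c; 4 * \<rho> * t / (1 + \<rho>)\<^sup>2)\<close>.
Expanding the powers of \<open>1 + \<rho>\<close> gives the coefficients
\<open>S lam N = (-1)\<^bsup>N\<^esup> (lam)\<^sub>N / N! F(-N, N + lam; c; t)\<close>, the polynomials \<open>scaled_jacobi\<close>
(lemma \<open>reduced_gen_fun_sums\<close>). This is only needed near the origin, because the
left-hand side is holomorphic in the disc; that in turn rests on the continuation of \<open>F\<close> to
the slit plane (theorem \<open>hypergeo_continues_to_slit_plane\<close>).

On the right, \<open>P\<^sub>n\<^bsup>(\<alpha>,\<beta>)\<^esup>(x)\<close> is a multiple of \<open>S a n\<close>, by reflection in \<open>t = 1/2\<close>, and Pfaff's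
transformation makes the \<open>n\<close>-th coefficient a power series starting with \<open>\<rho>\<^bsup>n\<^esup>\<close>. Collecting the
terms of degree \<open>N\<close> leaves a finite connection formula, which expresses \<open>S (a + m) N\<close> by
\<open>S a 0, \<dots>, S a N\<close> (lemma \<open>scaled_jacobi_connection\<close>). For each power of \<open>t\<close> it is a summable
very-well-poised hypergeometric sum.

The rearrangement needs a bound on \<open>S a n\<close>. It costs nothing: the case \<open>m = 0\<close> of the left-hand
side says that \<open>\<Sum> S a n * \<rho>\<^bsup>n\<^esup>\<close> converges in the unit disc, so \<open>S a n\<close> grows more slowly
than every geometric sequence with ratio above 1. The other factors have this property because the
quotients of consecutive terms tend to 1.

What remains is to see that the principal powers fit together. For \<open>|\<rho>| < 1\<close> and \<open>-1 \<le> x \<le> 1\<close> the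
radicand of \<open>R\<close> is not in \<open>(-\<infinity>, 0]\<close>, so \<open>R\<close> and \<open>q\<close> have positive real part, and the sign of
\<open>Im q\<close> is never opposite to that of \<open>Im \<rho>\<close>. At \<open>x = -1\<close> the reduced left-hand side is still continuous.\<close>

section \<open>Terminating hypergeometric sums\<close>

text \<open>Vandermonde's convolution for Pochhammer symbols, after \<open>(c)\<^sub>n / (c)\<^sub>k\<close> is reversed into
\<open>(-1)\<^bsup>n-k\<^esup> (1 - c - n)\<^bsub>n-k\<^esub>\<close>.\<close>
lemma chu_vandermonde:
  fixes b c :: "'a :: field_char_0"
  assumes "pochhammer c n \<noteq> 0"
  shows "(\<Sum>k\<le>n. pochhammer (- of_nat n) k * pochhammer b k / (pochhammer c k * fact k)) =
           pochhammer (c - b) n / pochhammer c n"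
proof -
  have "(\<Sum>k\<le>n. pochhammer (- of_nat n) k * pochhammer b k / (pochhammer c k * fact k)) * pochhammer c n =
        (\<Sum>k\<le>n. (-1) ^ n * (of_nat (n choose k) * pochhammer b k * pochhammer (1 - c - of_nat n) (n - k)))"
    unfolding sum_distrib_right
  proof (rule sum.cong)
    fix k assume k: "k \<in> {..n}"
    have c: "pochhammer c n = pochhammer c k * pochhammer (c + of_nat k) (n - k)"
      using k by (intro pochhammer_product) auto
    have "pochhammer (1 - c - of_nat n) (n - k) = pochhammer (-(c + of_nat n - 1)) (n - k)"
      by (simp add: algebra_simps)
    also have "\<dots> = (-1) ^ (n - k) * pochhammer (c + of_nat k) (n - k)"
      using k by (subst pochhammer_minus) (simp add: of_nat_diff)
    finally have d: "pochhammer (1 - c - of_nat n) (n - k) = (-1) ^ (n - k) * pochhammer (c + of_nat k) (n - k)" .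
    have e: "(of_nat (n choose k) :: 'a) = (-1) ^ k * pochhammer (- of_nat n) k / fact k"
      by (simp add: binomial_gbinomial gbinomial_pochhammer)
    have "(-1 :: 'a) ^ n = (-1) ^ k * (-1) ^ (n - k)"
      using k by (simp flip: power_add)
    then show "pochhammer (- of_nat n) k * pochhammer b k / (pochhammer c k * fact k) * pochhammer c n =
          (-1) ^ n * (of_nat (n choose k) * pochhammer b k * pochhammer (1 - c - of_nat n) (n - k))"
      using assms unfolding c d e by (simp add: field_simps)
  qed simp
  also have "\<dots> = (-1) ^ n * pochhammer (-(c + of_nat n - 1 - b)) n"
    unfolding sum_distrib_left [symmetric] pochhammer_binomial_sum [symmetric] by (simp add: algebra_simps)
  also have "\<dots> = pochhammer (c - b) n"
    by (subst pochhammer_minus) (simp add: algebra_simps)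
  finally show ?thesis
    using assms by (simp add: field_simps)
qed

lemma pochhammer_neg_of_nat:
  assumes "k \<le> n"
  shows "pochhammer (- of_nat n :: 'a :: field_char_0) k = (-1) ^ k * fact n / fact (n - k)"
proof -
  have "fact n = fact (n - k) * pochhammer (of_nat (n - k) + 1 :: 'a) k"
    using assms pochhammer_product'[of "1 :: 'a" "n - k" k]
    by (simp add: pochhammer_fact add.commute)
  then show ?thesis
    using assms by (simp add: pochhammer_minus of_nat_diff)
qed

text \<open>Expanding \<open>(1 - t)\<^bsup>k\<^esup>\<close> makes the coefficient of each power of \<open>t\<close> a terminating series at 1 with
shifted parameters, which the Chu-Vandermonde sum evaluates.\<close>
lemma gauss_2F1_terminating_reflection:
  fixes b c t :: complex
  assumes c: "pochhammer c n \<noteq> 0" and c': "pochhammer (c - b) n \<noteq> 0"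
  shows "gauss_2F1 (- of_nat n) b c (1 - t) =
           pochhammer (c - b) n / pochhammer c n * gauss_2F1 (- of_nat n) b (1 + b - c - of_nat n) t"
proof -
  define u where "u k = pochhammer (- of_nat n) k * pochhammer b k / (pochhammer c k * fact k)" for k
  have inner: "(\<Sum>k\<in>{j..n}. u k * of_nat (k choose j)) * (-1) ^ j =
      pochhammer (c - b) n / pochhammer c n *
        (pochhammer (- of_nat n) j * pochhammer b j / (pochhammer (1 + b - c - of_nat n) j * fact j))"
    if j: "j \<le> n" for j
  proof -
    have cj: "pochhammer c n = pochhammer c j * pochhammer (c + of_nat j) (n - j)"
      using j by (intro pochhammer_product) auto
    have "(\<Sum>k\<in>{j..n}. u k * of_nat (k choose j)) = (\<Sum>i\<le>n - j. u (j + i) * of_nat ((j + i) choose j))"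
      using j by (intro sum.reindex_bij_witness[of _ "\<lambda>i. j + i" "\<lambda>k. k - j"]) auto
    also have "\<dots> = (\<Sum>i\<le>n - j. u j * (pochhammer (- of_nat (n - j)) i * pochhammer (b + of_nat j) i /
                        (pochhammer (c + of_nat j) i * fact i)))"
    proof (rule sum.cong)
      fix i
      have "(of_nat ((j + i) choose j) :: complex) = fact (j + i) / (fact j * fact i)"
        by (simp add: binomial_fact)
      moreover have "- of_nat n + of_nat j = (- of_nat (n - j) :: complex)"
        using j by (simp add: of_nat_diff)
      ultimately show "u (j + i) * of_nat ((j + i) choose j) =
          u j * (pochhammer (- of_nat (n - j)) i * pochhammer (b + of_nat j) i /
                        (pochhammer (c + of_nat j) i * fact i))"
        unfolding u_def pochhammer_product' by (simp only:) (simp add: divide_inverse mult_ac)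
    qed simp
    also have "\<dots> = u j * (pochhammer (c - b) (n - j) / pochhammer (c + of_nat j) (n - j))"
      unfolding sum_distrib_left [symmetric]
      by (subst chu_vandermonde) (use c cj in auto)
    finally have 1: "(\<Sum>k\<in>{j..n}. u k * of_nat (k choose j)) =
        u j * (pochhammer (c - b) (n - j) / pochhammer (c + of_nat j) (n - j))" .
    have "pochhammer (1 + b - c - of_nat n) j = pochhammer (- (c - b + of_nat n - 1)) j"
      by (simp add: algebra_simps)
    also have "\<dots> = (-1) ^ j * pochhammer (c - b + of_nat (n - j)) j"
      using j by (subst pochhammer_minus) (simp add: of_nat_diff algebra_simps)
    finally have 2: "pochhammer (1 + b - c - of_nat n) j = (-1) ^ j * pochhammer (c - b + of_nat (n - j)) j" .
    have 3: "pochhammer (c - b) n = pochhammer (c - b) (n - j) * pochhammer (c - b + of_nat (n - j)) j"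
      using pochhammer_product'[of "c - b" "n - j" j] j by simp
    show ?thesis
      using c c' unfolding 1 2 3 cj by (simp add: u_def field_simps)
  qed
  have "gauss_2F1 (- of_nat n) b c (1 - t) = (\<Sum>k\<le>n. u k * (- t + 1) ^ k)"
    by (simp add: gauss_2F1_terminating u_def field_simps)
  also have "\<dots> = (\<Sum>k\<le>n. \<Sum>j\<in>{j\<in>{..n}. j \<le> k}. u k * of_nat (k choose j) * (-1) ^ j * t ^ j)"
    by (intro sum.cong refl, subst binomial_ring)
       (auto simp: sum_distrib_left power_minus[of t] mult_ac intro!: sum.cong)
  also have "\<dots> = (\<Sum>j\<le>n. \<Sum>k\<in>{k\<in>{..n}. j \<le> k}. u k * of_nat (k choose j) * (-1) ^ j * t ^ j)"
    by (rule sum.swap_restrict) auto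
  also have "\<dots> = (\<Sum>j\<le>n. (\<Sum>k\<in>{j..n}. u k * of_nat (k choose j)) * (-1) ^ j * t ^ j)"
    by (intro sum.cong refl) (auto simp: sum_distrib_right intro!: sum.cong)
  also have "\<dots> = (\<Sum>j\<le>n. pochhammer (c - b) n / pochhammer c n *
        (pochhammer (- of_nat n) j * pochhammer b j / (pochhammer (1 + b - c - of_nat n) j * fact j)) * t ^ j)"
    using inner by (intro sum.cong refl) auto
  also have "\<dots> = pochhammer (c - b) n / pochhammer c n * gauss_2F1 (- of_nat n) b (1 + b - c - of_nat n) t"
    by (simp add: gauss_2F1_terminating sum_distrib_left field_simps)
  finally show ?thesis .
qed

text \<open>For \<open>lam = \<alpha> + \<beta> + 1\<close>, \<open>c = \<beta> + 1\<close> and \<open>t = (1 + x) / 2\<close> this is the Jacobi polynomial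
\<open>P\<^sub>n\<^bsup>(\<alpha>,\<beta>)\<^esup>(x)\<close> times \<open>(lam)\<^sub>n / (c)\<^sub>n\<close>. In this normalization the numbers \<open>(c)\<^sub>k\<close> enter
only through the factor \<open>t\<^bsup>k\<^esup> / (c)\<^sub>k\<close>, so that changing \<open>\<alpha>\<close> changes \<open>lam\<close> alone.\<close>
definition scaled_jacobi :: "complex \<Rightarrow> complex \<Rightarrow> complex \<Rightarrow> nat \<Rightarrow> complex" where
  "scaled_jacobi lam c t n =
     (-1) ^ n * pochhammer lam n / fact n * gauss_2F1 (- of_nat n) (of_nat n + lam) c t"

lemma scaled_jacobi_altdef:
  "scaled_jacobi lam c t n =
     (\<Sum>k\<le>n. (-1) ^ (n - k) * pochhammer lam (n + k) / (fact (n - k) * fact k * pochhammer c k) * t ^ k)"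
  unfolding scaled_jacobi_def gauss_2F1_terminating sum_distrib_left
proof (intro sum.cong refl)
  fix k assume "k \<in> {..n}"
  then have k: "k \<le> n" by simp
  have "(-1 :: complex) ^ (n - k) = (-1) ^ n * (-1) ^ k"
    using k by (simp add: minus_one_power_iff)
  then show "(-1) ^ n * pochhammer lam n / fact n *
      (pochhammer (- of_nat n) k * pochhammer (of_nat n + lam) k / pochhammer c k * t ^ k / fact k) =
      (-1) ^ (n - k) * pochhammer lam (n + k) / (fact (n - k) * fact k * pochhammer c k) * t ^ k"
    by (simp add: pochhammer_neg_of_nat[OF k] pochhammer_product' add.commute[of "of_nat n" lam] mult_ac)
qed

text \<open>At \<open>t = 1\<close> the polynomials become the coefficients of a hypergeometric series; this is how the
quadratic transformation arises as a special case of the generating function.\<close>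
lemma scaled_jacobi_1:
  assumes "pochhammer c n \<noteq> 0"
  shows "scaled_jacobi lam c 1 n = pochhammer lam n * pochhammer (lam - c + 1) n / (pochhammer c n * fact n)"
proof -
  have "gauss_2F1 (- of_nat n) (of_nat n + lam) c 1 = pochhammer (c - (of_nat n + lam)) n / pochhammer c n"
    using chu_vandermonde[OF assms, of "of_nat n + lam"] by (simp add: gauss_2F1_terminating)
  also have "pochhammer (c - (of_nat n + lam)) n = pochhammer (- (lam - c + of_nat n)) n"
    by (simp add: algebra_simps)
  also have "\<dots> = (-1) ^ n * pochhammer (lam - c + 1) n"
    by (subst pochhammer_minus) simp
  finally show ?thesis
    by (simp add: scaled_jacobi_def field_simps flip: power_mult_distrib)
qed

text \<open>The definition of the Jacobi polynomials expands about \<open>x = 1\<close>, while the generating function expands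
about \<open>x = -1\<close>; the reflection formula mediates between the two.\<close>
lemma jacobi_P_conv_scaled_jacobi:
  assumes "pochhammer (\<alpha> + 1) n \<noteq> 0" "pochhammer (\<beta> + 1) n \<noteq> 0"
  shows "pochhammer (\<alpha> + \<beta> + 1) n / pochhammer (\<beta> + 1) n * jacobi_P n \<alpha> \<beta> x =
         scaled_jacobi (\<alpha> + \<beta> + 1) (\<beta> + 1) ((1 + x) / 2) n"
proof -
  have 1: "pochhammer (\<alpha> + 1 - (of_nat n + \<alpha> + \<beta> + 1)) n = (-1) ^ n * pochhammer (\<beta> + 1) n"
    using pochhammer_minus[of "\<beta> + of_nat n" n] by (simp add: algebra_simps)
  have "gauss_2F1 (- of_nat n) (of_nat n + \<alpha> + \<beta> + 1) (\<alpha> + 1) (1 - (1 + x) / 2) =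
      (-1) ^ n * pochhammer (\<beta> + 1) n / pochhammer (\<alpha> + 1) n *
      gauss_2F1 (- of_nat n) (of_nat n + \<alpha> + \<beta> + 1) (\<beta> + 1) ((1 + x) / 2)"
    using gauss_2F1_terminating_reflection[of "\<alpha> + 1" n "of_nat n + \<alpha> + \<beta> + 1" "(1 + x) / 2"] assms
    unfolding 1 by (simp add: algebra_simps)
  moreover have "1 - (1 + x) / 2 = (1 - x) / 2"
    by (simp add: field_simps)
  ultimately show ?thesis
    using assms by (simp add: jacobi_P_def scaled_jacobi_def algebra_simps)
qed

text \<open>Up to normalization the left-hand side is the terminating very-well-poised series
\<open>\<^sub>4F\<^sub>3(a, 1 + a/2, -M, a + m + M; a/2, 1 + a + M, 1 - m - M; -1)\<close> with \<open>m = l + 1\<close>. Passing from \<open>m\<close>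
to \<open>m + 1\<close> multiplies the sum by \<open>a + m + M\<close>: if \<open>T m i\<close> denotes the summand, then
\<open>T (m + 1) i - (a + m + M) * T m i\<close> telescopes. The antidifference \<open>G\<close> of the proof is
the summand times the rational function \<open>- i * (m + M - i) * (a + M + i) / (m * (2 * i + a))\<close>.\<close>
lemma very_well_poised_sum:
  fixes a :: "'a :: field_char_0"
  assumes a: "\<And>i. a + of_nat i \<noteq> 0"
  shows "(\<Sum>i\<le>M. (-1) ^ i * (2 * of_nat i + a) * pochhammer a i / fact i *
            (pochhammer (of_nat (Suc l)) (M - i) / fact (M - i)) * pochhammer (a + of_nat M + of_nat i + 1) l) =
         (-1) ^ M * pochhammer a (Suc l + M) / fact M"
proof (induction l)
  case 0
  have "(\<Sum>i\<le>M. (-1) ^ i * (2 * of_nat i + a) * pochhammer a i / fact i) =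
         (-1) ^ M * pochhammer a (Suc M) / fact M"
  proof (induction M)
    case (Suc M)
    show ?case
    proof -
      define K F Y where "K = (of_nat (Suc M) :: 'a)" and "F = (fact M :: 'a)" and "Y = pochhammer a (Suc M)"
      have "K \<noteq> 0" "F \<noteq> 0"
        unfolding K_def F_def by (simp_all del: of_nat_Suc)
      then have "(-1) ^ M * Y / F + (-1) ^ Suc M * (2 * K + a) * Y / (K * F) =
          (-1) ^ Suc M * (Y * (a + K)) / (K * F)"
        by (simp add: field_simps)
      then show ?thesis
        unfolding sum.atMost_Suc Suc.IH K_def F_def Y_def
        by (simp only: fact_Suc pochhammer_Suc[of a "Suc M"])
    qed
  qed simp
  moreover have "pochhammer (of_nat (Suc 0) :: 'a) k / fact k = 1" for k
    using fact_nonzero[of k, where ?'a = 'a] by (simp flip: pochhammer_fact)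
  ultimately show ?case by simp
next
  case (Suc l)
  define T where "T l i = (-1) ^ i * (2 * of_nat i + a) * pochhammer a i / fact i *
            (pochhammer (of_nat (Suc l)) (M - i) / fact (M - i)) * pochhammer (a + of_nat M + of_nat i + 1) l" for l i
  define G where "G i = - ((-1) ^ i * pochhammer a i / fact i * of_nat i *
      (pochhammer (of_nat (Suc l)) (M + 1 - i) / fact (M - i)) * pochhammer (a + of_nat M + of_nat i) (Suc l)) / of_nat (Suc l)" for i
  define s where "s = (of_nat (Suc l) :: 'a)"
  have s: "s \<noteq> 0" unfolding s_def by (rule of_nat_neq_0)
  have Z1: "pochhammer (a + of_nat M + of_nat i + 1) (Suc l) =
      pochhammer (a + of_nat M + of_nat i + 1) l * (a + of_nat M + of_nat i + s)" for i
    by (simp add: pochhammer_Suc s_def add_ac)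
  have Z2: "pochhammer (a + of_nat M + of_nat i) (Suc l) =
      (a + of_nat M + of_nat i) * pochhammer (a + of_nat M + of_nat i + 1) l" for i
    by (simp add: pochhammer_rec)
  have P1: "pochhammer (of_nat (Suc (Suc l)) :: 'a) j = pochhammer s j * (s + of_nat j) / s" for j
  proof -
    have "of_nat (Suc (Suc l)) = s + (1 :: 'a)"
      by (simp add: s_def add_ac)
    then show ?thesis
      using s pochhammer_rec[of s j] pochhammer_rec'[of s j] by (simp add: field_simps)
  qed
  \<comment> \<open>After the common factor \<open>W\<close> is removed, this is a polynomial identity in \<open>a\<close>, \<open>s\<close>, \<open>I\<close> and \<open>K\<close>. The term
      \<open>i = M\<close> is treated separately, since there \<open>G (Suc i)\<close> should be 0 but truncated subtraction spoils it.\<close>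
  have step: "T (Suc l) i - (a + s + of_nat M) * T l i = G (Suc i) - G i" if "i < M" for i
  proof -
    from that obtain k where M: "M = i + k + 1"
      by (metis Suc_eq_plus1 add_Suc_right less_imp_Suc_add)
    define W where "W = (-1) ^ i * pochhammer a i / fact i * pochhammer s k *
      pochhammer (a + of_nat M + of_nat i + 1) l / fact k"
    define I K where "I = (of_nat i :: 'a)" and "K = (of_nat k :: 'a)"
    have K: "K + 1 \<noteq> 0" "I + 1 \<noteq> 0"
      unfolding K_def I_def by (metis of_nat_Suc of_nat_neq_0 add.commute)+
    have MIK: "of_nat M = I + K + 1" by (simp add: M I_def K_def)
    have Mi: "M - i = Suc k" "M + 1 - i = Suc (Suc k)" "M + 1 - Suc i = Suc k" "M - Suc i = k"
      by (auto simp: M)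
    have T1: "T l i = W * (2 * I + a) * (s + K) / (K + 1)"
      by (simp add: T_def W_def Mi pochhammer_Suc I_def K_def s_def field_simps)
    have T2: "T (Suc l) i = W * (2 * I + a) * (s + K) * (s + K + 1) * (a + of_nat M + I + s) / (s * (K + 1))"
      unfolding T_def P1 Z1 Mi by (simp add: W_def pochhammer_Suc I_def K_def field_simps)
    have G1: "G i = - (W * I * (s + K) * (s + K + 1) * (a + of_nat M + I) / (s * (K + 1)))"
      unfolding G_def Z2 Mi s_def [symmetric]
      by (simp add: W_def pochhammer_Suc I_def K_def field_simps)
    have Z3: "pochhammer (a + of_nat M + of_nat (Suc i)) (Suc l) =
      pochhammer (a + of_nat M + of_nat i + 1) l * (a + of_nat M + of_nat i + s)"
      using Z1[of i] by (simp add: add_ac)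
    have G2: "G (Suc i) = W * (a + I) * (s + K) * (a + of_nat M + I + s) / s"
      unfolding G_def Z3 Mi s_def [symmetric] using K
      by (simp add: W_def pochhammer_Suc I_def K_def fact_Suc del: of_nat_Suc)
    show ?thesis
      unfolding T1 T2 G1 G2 MIK using K s
      by (simp add: divide_simps) (simp add: algebra_simps)
  qed
  have last: "T (Suc l) M - (a + s + of_nat M) * T l M = - G M"
  proof -
    have "T (Suc l) M = T l M * (a + of_nat M + of_nat M + s)"
      unfolding T_def Z1 by simp
    moreover define V where "V = (-1) ^ M * pochhammer a M / fact M * pochhammer (a + of_nat M + of_nat M + 1) l"
    have "T l M = (2 * of_nat M + a) * V"
      by (simp add: T_def V_def)
    moreover have "G M = - (V * of_nat M * (a + of_nat M + of_nat M))"
      unfolding G_def Z2 s_def [symmetric] V_def using s by simp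
    ultimately show ?thesis
      by (simp only:) (simp add: algebra_simps)
  qed
  have "(\<Sum>i\<le>M. T (Suc l) i) - (a + s + of_nat M) * (\<Sum>i\<le>M. T l i) =
        (\<Sum>i<M. T (Suc l) i - (a + s + of_nat M) * T l i) + (T (Suc l) M - (a + s + of_nat M) * T l M)"
    unfolding lessThan_Suc_atMost [symmetric] sum.lessThan_Suc sum_subtractf sum_distrib_left [symmetric]
    by (simp add: algebra_simps)
  also have "(\<Sum>i<M. T (Suc l) i - (a + s + of_nat M) * T l i) = (\<Sum>i<M. G (Suc i) - G i)"
    using step by (intro sum.cong) auto
  also have "\<dots> = G M - G 0"
    by (rule sum_lessThan_telescope)
  also have "G 0 = 0"
    by (simp add: G_def)
  finally have "(\<Sum>i\<le>M. T (Suc l) i) = (a + s + of_nat M) * (\<Sum>i\<le>M. T l i)"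
    by (simp add: last)
  also have "(\<Sum>i\<le>M. T l i) = (-1) ^ M * pochhammer a (Suc l + M) / fact M"
    using Suc.IH by (simp add: T_def)
  also have "(a + s + of_nat M) * ((-1) ^ M * pochhammer a (Suc l + M) / fact M) =
      (-1) ^ M * pochhammer a (Suc (Suc l) + M) / fact M"
    using pochhammer_Suc[of a "Suc l + M"] by (simp add: s_def add_ac)
  finally show ?case
    unfolding T_def .
qed

text \<open>This compares the coefficients of \<open>t\<^bsup>k\<^esup>\<close> in the connection formula below. Shifting the summation
index by \<open>k\<close> replaces \<open>a\<close> by \<open>a + 2 * k\<close> and gives the very-well-poised sum; for \<open>m = 0\<close>, which
that sum does not cover, only the term \<open>n = N\<close> survives.\<close>
lemma connection_coefficient_sum:
  fixes a :: "'a :: field_char_0"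
  assumes a: "\<And>i. a + of_nat i \<noteq> 0" and kN: "k \<le> N"
  shows "(\<Sum>n\<in>{k..N}. (2 * of_nat n + a) * ((-1) ^ (n - k) * pochhammer a (n + k) / fact (n - k)) *
            (pochhammer (of_nat m) (N - n) / fact (N - n)) *
            (pochhammer (a + of_nat m) (n + N) / pochhammer a (n + N + 1))) =
         (-1) ^ (N - k) * pochhammer (a + of_nat m) (N + k) / fact (N - k)"
proof -
  have nz: "pochhammer a j \<noteq> 0" for j
    using a by (metis pochhammer_eq_0_iff add.commute add_uminus_conv_diff diff_self)
  show ?thesis
  proof (cases m)
    case 0
    have "(\<Sum>n\<in>{k..N}. (2 * of_nat n + a) * ((-1) ^ (n - k) * pochhammer a (n + k) / fact (n - k)) *
              (pochhammer (of_nat m) (N - n) / fact (N - n)) *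
              (pochhammer (a + of_nat m) (n + N) / pochhammer a (n + N + 1))) =
          (\<Sum>n\<in>{k..N}. if n = N then (-1) ^ (N - k) * pochhammer a (N + k) / fact (N - k) else 0)"
    proof (rule sum.cong)
      fix n assume n: "n \<in> {k..N}"
      show "(2 * of_nat n + a) * ((-1) ^ (n - k) * pochhammer a (n + k) / fact (n - k)) *
              (pochhammer (of_nat m) (N - n) / fact (N - n)) *
              (pochhammer (a + of_nat m) (n + N) / pochhammer a (n + N + 1)) =
            (if n = N then (-1) ^ (N - k) * pochhammer a (N + k) / fact (N - k) else 0)"
      proof (cases "n = N")
        case True
        have "pochhammer a (N + N) / pochhammer a (N + N + 1) = 1 / (2 * of_nat N + a)"
        proof -
          have "pochhammer a (N + N + 1) = (2 * of_nat N + a) * pochhammer a (N + N)"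
            using pochhammer_rec'[of a "N + N"] by (simp add: add_ac)
          then show ?thesis using nz[of "N + N"] by (simp only:) simp
        qed
        moreover have "2 * of_nat N + a \<noteq> 0"
          using a[of "2 * N"] by (simp add: add.commute)
        ultimately show ?thesis
          unfolding True 0 by simp
      next
        case False
        then have "0 < N - n"
          using n by auto
        then have "pochhammer (0 :: 'a) (N - n) = 0"
          by (simp add: pochhammer_0_left)
        then show ?thesis
          unfolding 0 using False by simp
      qed
    qed simp
    also have "\<dots> = (-1) ^ (N - k) * pochhammer a (N + k) / fact (N - k)"
      using kN by simp
    finally show ?thesis using 0 by simp
  next
    case (Suc l)
    define M where "M = N - k"
    define b where "b = a + of_nat (2 * k)"
    have "(\<Sum>n\<in>{k..N}. (2 * of_nat n + a) * ((-1) ^ (n - k) * pochhammer a (n + k) / fact (n - k)) *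
              (pochhammer (of_nat m) (N - n) / fact (N - n)) *
              (pochhammer (a + of_nat m) (n + N) / pochhammer a (n + N + 1))) =
          (\<Sum>i\<le>M. (2 * of_nat (k + i) + a) * ((-1) ^ i * pochhammer a (k + i + k) / fact i) *
              (pochhammer (of_nat m) (M - i) / fact (M - i)) *
              (pochhammer (a + of_nat m) (k + i + N) / pochhammer a (k + i + N + 1)))"
    proof (rule sum.reindex_bij_witness[of _ "\<lambda>i. k + i" "\<lambda>n. n - k"])
      fix n assume "n \<in> {k..N}"
      then have n: "k + (n - k) = n" "M - (n - k) = N - n"
        by (auto simp: M_def)
      show "(2 * of_nat (k + (n - k)) + a) * ((-1) ^ (n - k) * pochhammer a (k + (n - k) + k) / fact (n - k)) *
              (pochhammer (of_nat m) (M - (n - k)) / fact (M - (n - k))) *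
              (pochhammer (a + of_nat m) (k + (n - k) + N) / pochhammer a (k + (n - k) + N + 1)) =
            (2 * of_nat n + a) * ((-1) ^ (n - k) * pochhammer a (n + k) / fact (n - k)) *
              (pochhammer (of_nat m) (N - n) / fact (N - n)) *
              (pochhammer (a + of_nat m) (n + N) / pochhammer a (n + N + 1))"
        unfolding n ..
    qed (use kN in \<open>auto simp: M_def\<close>)
    also have "\<dots> = (\<Sum>i\<le>M. pochhammer a (2 * k) / pochhammer a m *
       ((-1) ^ i * (2 * of_nat i + b) * pochhammer b i / fact i *
              (pochhammer (of_nat (Suc l)) (M - i) / fact (M - i)) * pochhammer (b + of_nat M + of_nat i + 1) l))"
    proof (rule sum.cong)
      fix i assume i: "i \<in> {..M}"
      have 1: "pochhammer a (k + i + k) = pochhammer a (2 * k) * pochhammer b i"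
      proof -
        have "k + i + k = 2 * k + i" by simp
        then show ?thesis
          unfolding b_def by (simp only: pochhammer_product')
      qed
      have "pochhammer a m * pochhammer (a + of_nat m) (k + i + N) =
            pochhammer a (k + i + N + 1) * pochhammer (a + of_nat (k + i + N + 1)) l"
        unfolding pochhammer_product' [symmetric] by (simp add: Suc add_ac)
      also have "a + of_nat (k + i + N + 1) = b + of_nat M + of_nat i + 1"
        using kN by (simp add: b_def M_def of_nat_diff add_ac)
      finally have 2: "pochhammer (a + of_nat m) (k + i + N) / pochhammer a (k + i + N + 1) =
          pochhammer (b + of_nat M + of_nat i + 1) l / pochhammer a m"
        using nz[of m] nz[of "k + i + N + 1"] by (simp only: frac_eq_eq mult.commute not_False_eq_True)
      have 3: "2 * of_nat (k + i) + a = 2 * of_nat i + b"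
        by (simp add: b_def algebra_simps)
      show "(2 * of_nat (k + i) + a) * ((-1) ^ i * pochhammer a (k + i + k) / fact i) *
              (pochhammer (of_nat m) (M - i) / fact (M - i)) *
              (pochhammer (a + of_nat m) (k + i + N) / pochhammer a (k + i + N + 1)) =
          pochhammer a (2 * k) / pochhammer a m *
       ((-1) ^ i * (2 * of_nat i + b) * pochhammer b i / fact i *
              (pochhammer (of_nat (Suc l)) (M - i) / fact (M - i)) * pochhammer (b + of_nat M + of_nat i + 1) l)"
        unfolding 1 2 3 unfolding Suc by (simp only: divide_inverse mult_ac)
    qed simp
    also have "\<dots> = pochhammer a (2 * k) / pochhammer a m * ((-1) ^ M * pochhammer b (Suc l + M) / fact M)"
      unfolding sum_distrib_left [symmetric]
    proof (subst very_well_poised_sum)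
      show "b + of_nat i \<noteq> 0" for i
        using a[of "2 * k + i"] by (simp add: b_def add_ac)
    qed simp
    finally have lhs: "(\<Sum>n\<in>{k..N}. (2 * of_nat n + a) * ((-1) ^ (n - k) * pochhammer a (n + k) / fact (n - k)) *
              (pochhammer (of_nat m) (N - n) / fact (N - n)) *
              (pochhammer (a + of_nat m) (n + N) / pochhammer a (n + N + 1))) =
           pochhammer a (2 * k) / pochhammer a m * ((-1) ^ M * pochhammer b (Suc l + M) / fact M)" .
    have eq: "pochhammer a (2 * k) * pochhammer b (Suc l + M) = pochhammer a m * pochhammer (a + of_nat m) (N + k)"
      unfolding b_def pochhammer_product' [symmetric] using kN by (simp add: M_def Suc add_ac mult_2)
    have "pochhammer a (2 * k) / pochhammer a m * ((-1) ^ M * pochhammer b (Suc l + M) / fact M) =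
        (-1) ^ M * pochhammer (a + of_nat m) (N + k) / fact M"
    proof -
      have "A / B * (C * D / E) = C * F / E" if "A * D = B * F" "B \<noteq> 0" for A B C D E F :: 'a
        using that by (simp add: divide_simps)
      from this[OF eq nz[of m]] show ?thesis .
    qed
    then show ?thesis
      unfolding lhs by (simp only: M_def)
  qed
qed

text \<open>The classical connection formula between Jacobi polynomials with parameters \<open>(\<alpha> + m, \<beta>)\<close> and \<open>(\<alpha>, \<beta>)\<close>.
It is checked on the coefficients of \<open>t\<^bsup>k\<^esup> / (k! (c)\<^sub>k)\<close>.\<close>
lemma scaled_jacobi_connection:
  assumes a: "\<And>i. a + of_nat i \<noteq> 0"
  shows "scaled_jacobi (a + of_nat m) c t N =
    (\<Sum>n\<le>N. (2 * of_nat n + a) * scaled_jacobi a c t n * (pochhammer (of_nat m) (N - n) / fact (N - n)) *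
            (pochhammer (a + of_nat m) (n + N) / pochhammer a (n + N + 1)))"
proof -
  define w where "w n = (pochhammer (of_nat m) (N - n) / fact (N - n)) *
            (pochhammer (a + of_nat m) (n + N) / pochhammer a (n + N + 1))" for n
  define g where "g k = t ^ k / (fact k * pochhammer c k)" for k
  have "(\<Sum>n\<le>N. (2 * of_nat n + a) * scaled_jacobi a c t n * (pochhammer (of_nat m) (N - n) / fact (N - n)) *
            (pochhammer (a + of_nat m) (n + N) / pochhammer a (n + N + 1))) =
        (\<Sum>n\<le>N. \<Sum>k\<in>{k\<in>{..N}. k \<le> n}. g k * ((2 * of_nat n + a) *
            ((-1) ^ (n - k) * pochhammer a (n + k) / fact (n - k)) * w n))"
    unfolding scaled_jacobi_altdef
    by (intro sum.cong refl)
       (auto simp: sum_distrib_left sum_distrib_right w_def g_def mult_ac intro!: sum.cong)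
  also have "\<dots> = (\<Sum>k\<le>N. \<Sum>n\<in>{n\<in>{..N}. k \<le> n}. g k * ((2 * of_nat n + a) *
            ((-1) ^ (n - k) * pochhammer a (n + k) / fact (n - k)) * w n))"
    by (rule sum.swap_restrict) auto
  also have "\<dots> = (\<Sum>k\<le>N. g k * (\<Sum>n\<in>{k..N}. (2 * of_nat n + a) *
            ((-1) ^ (n - k) * pochhammer a (n + k) / fact (n - k)) * w n))"
    by (intro sum.cong refl) (auto simp: sum_distrib_left intro!: sum.cong)
  also have "\<dots> = (\<Sum>k\<le>N. g k * ((-1) ^ (N - k) * pochhammer (a + of_nat m) (N + k) / fact (N - k)))"
    by (intro sum.cong refl) (use connection_coefficient_sum[OF a, of _ N m] in \<open>auto simp: w_def mult.assoc\<close>)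
  also have "\<dots> = scaled_jacobi (a + of_nat m) c t N"
    unfolding scaled_jacobi_altdef by (intro sum.cong refl) (simp add: g_def divide_inverse mult_ac)
  finally show ?thesis ..
qed

section \<open>Continuation of the hypergeometric series to the slit plane\<close>

text \<open>Agreement with the series is expressed by the power series at 0 alone: for functions that are
holomorphic in the slit plane this determines the values, and it is stable under the algebraic
operations used below.\<close>
definition continues_to_slit_plane :: "complex \<Rightarrow> complex \<Rightarrow> complex \<Rightarrow> bool" where
  "continues_to_slit_plane a b c \<longleftrightarrow>
     (\<exists>f. f holomorphic_on slit_plane \<and> f has_fps_expansion fps_hypergeo [a, b] [c] 1)"

lemma Beta_pochhammer_ratio:
  fixes b d :: real
  assumes "b > 0" "d > 0"
  shows "Beta (b + of_nat n) d = Beta b d * pochhammer b n / pochhammer (b + d) n"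
proof -
  have "pochhammer b n = Gamma (b + of_nat n) / Gamma b"
    using assms by (intro pochhammer_Gamma) (auto elim!: nonpos_Ints_cases)
  moreover have "pochhammer (b + d) n = Gamma (b + d + of_nat n) / Gamma (b + d)"
    using assms by (intro pochhammer_Gamma) (auto elim!: nonpos_Ints_cases)
  moreover have "Gamma b > 0" "Gamma (b + d) > 0" "Gamma (b + d + of_nat n) > 0"
    using assms by (auto intro!: Gamma_real_pos)
  ultimately show ?thesis
    by (simp add: Beta_def field_simps)
qed

lemma has_integral_Beta_moment:
  fixes b d :: real
  assumes "b > 0" "d > 0"
  shows "((\<lambda>t. t ^ n * (t powr (b - 1) * (1 - t) powr (d - 1))) has_integral
            Beta b d * pochhammer b n / pochhammer (b + d) n) {0..1}"
proof -
  have "((\<lambda>t. t powr (b + of_nat n - 1) * (1 - t) powr (d - 1)) has_integral Beta (b + of_nat n) d) {0..1}"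
    using assms by (intro has_integral_Beta_real) auto
  moreover have "t powr (b + of_nat n - 1) * (1 - t) powr (d - 1) =
        t ^ n * (t powr (b - 1) * (1 - t) powr (d - 1))" if "t \<in> {0..1}" for t
  proof (cases "t = 0")
    case False
    then have "t powr (b - 1 + of_nat n) = t powr (b - 1) * t ^ n"
      using that by (simp add: powr_add powr_realpow)
    then show ?thesis
      by (simp add: algebra_simps)
  qed auto
  ultimately show ?thesis
    using Beta_pochhammer_ratio[OF assms] by (subst has_integral_cong[symmetric]) auto
qed

text \<open>The power in Euler's integral has no branch point or cut on the path of integration.\<close>
lemma slit_plane_segment:
  assumes "z \<in> slit_plane" "0 \<le> t" "t \<le> 1"
  shows "1 - of_real t * z \<notin> \<real>\<^sub>\<le>\<^sub>0"
proof
  assume "1 - of_real t * z \<in> \<real>\<^sub>\<le>\<^sub>0"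
  then obtain s where s: "s \<le> 0" "1 - of_real t * z = of_real s"
    by (auto elim!: nonpos_Reals_cases)
  then have "t \<noteq> 0"
    by auto
  then have "z = of_real ((1 - s) / t)" "(1 - s) / t \<ge> 1"
    using s assms by (auto simp: field_simps)
  then show False
    using assms(1) unfolding slit_plane_def by (metis ComplD atLeast_iff imageI)
qed

text \<open>Euler's integral \<open>\<integral>\<^bsub>0..1\<^esub> t\<^bsup>b-1\<^esup> (1 - t)\<^bsup>d-1\<^esup> (1 - t z)\<^bsup>-a\<^esup> dt\<close> is holomorphic in the slit plane, and
integrating the binomial series of \<open>(1 - t z)\<^bsup>-a\<^esup>\<close> term by term gives the hypergeometric series with
\<open>c = b + d\<close>. The assumption that both exponents are positive makes the weight continuous on the
closed interval, so that differentiation under the integral sign is immediate; contiguous relations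
lead from there to the remaining parameters.\<close>
lemma continues_by_Euler_integral:
  fixes b d :: real
  assumes b: "b > 1" and d: "d > 1"
  shows "continues_to_slit_plane a (of_real b) (of_real (b + d))"
proof -
  define w where "w = (\<lambda>t. t powr (b - 1) * (1 - t) powr (d - 1))"
  have w [continuous_intros]: "continuous_on A (\<lambda>x. w (g x))"
    if "continuous_on A g" "\<And>x. x \<in> A \<Longrightarrow> g x \<in> {0..1}" for A and g :: "'b :: topological_space \<Rightarrow> real"
    unfolding w_def
    by (intro continuous_on_mult continuous_on_powr' continuous_on_diff continuous_on_const that(1) ballI)
       (use that(2) b d in fastforce)+
  define F where "F = (\<lambda>z. integral (cbox 0 1) (\<lambda>t. of_real (w t) * (1 - of_real t * z) powr (-a)))"
  have "F field_differentiable (at z0)" if z0: "z0 \<in> slit_plane" for z0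
  proof -
    obtain r where r: "r > 0" "ball z0 r \<subseteq> slit_plane"
      using open_slit_plane z0 open_contains_ball by blast
    have nz: "1 - of_real t * z \<notin> \<real>\<^sub>\<le>\<^sub>0" if "z \<in> ball z0 r" "t \<in> cbox 0 1" for t z
      using slit_plane_segment[of z t] that r by auto
    then have nz': "x * Re z \<le> 1 \<or> x * Im z \<noteq> 0" "of_real x * z \<noteq> 1"
      if "dist z0 z < r" "0 \<le> x" "x \<le> 1" for x z
    proof -
      have "1 - of_real x * z \<notin> \<real>\<^sub>\<le>\<^sub>0"
        using that by (intro nz) auto
      then show "x * Re z \<le> 1 \<or> x * Im z \<noteq> 0"
        by (auto simp: complex_nonpos_Reals_iff)
      show "of_real x * z \<noteq> 1"
      proof
        assume "of_real x * z = 1"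
        then have "1 - of_real x * z \<in> \<real>\<^sub>\<le>\<^sub>0" by simp
        with \<open>1 - of_real x * z \<notin> \<real>\<^sub>\<le>\<^sub>0\<close> show False by blast
      qed
    qed
    have "F holomorphic_on ball z0 r"
      unfolding F_def
    proof (rule leibniz_rule_holomorphic)
      fix z t assume zt: "z \<in> ball z0 r" "t \<in> cbox 0 (1 :: real)"
      show "((\<lambda>z. of_real (w t) * (1 - of_real t * z) powr (-a)) has_field_derivative
               of_real (w t) * (a * of_real t * (1 - of_real t * z) powr (-a - 1))) (at z within ball z0 r)"
        using nz[OF zt] by (auto intro!: derivative_eq_intros simp: algebra_simps)
    next
      fix z assume z: "z \<in> ball z0 r"
      show "(\<lambda>t. of_real (w t) * (1 - of_real t * z) powr (-a)) integrable_on cbox 0 1"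
        using z nz' by (intro integrable_continuous continuous_intros) fastforce+
    next
      show "continuous_on (ball z0 r \<times> cbox 0 1)
              (\<lambda>(z, t). of_real (w t) * (a * of_real t * (1 - of_real t * z) powr (-a - 1)))"
        unfolding case_prod_unfold using nz' by (intro continuous_intros) fastforce+
    qed auto
    then show ?thesis
      using r by (simp add: holomorphic_on_imp_differentiable_at)
  qed
  then have holo: "F holomorphic_on slit_plane"
    by (auto simp: holomorphic_on_def intro: field_differentiable_at_within)
  have sums: "(\<lambda>n. fps_nth (fps_hypergeo [a, of_real b] [of_real (b + d)] 1) n * z ^ n) sums (F z / of_real (Beta b d))"
    if z: "norm z < 1" for z
  proof -
    define u where "u n = pochhammer a n / fact n * z ^ n" for n
    have u: "(\<lambda>n. u n * of_real t ^ n) sums (1 - of_real t * z) powr (-a)" if t: "t \<in> {0..1}" for t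
    proof -
      have "norm (- (of_real t * z)) < 1"
        using z t by (simp add: norm_mult) (metis mult_left_le_one_le norm_ge_zero order_le_less_trans)
      moreover have sgn: "(-1) ^ n * (- y) ^ n = y ^ n" for y :: complex and n
        by (simp flip: power_mult_distrib)
      ultimately show ?thesis
        using gen_binomial_complex[of "- (of_real t * z)" "-a"]
        by (simp add: u_def gbinomial_pochhammer sgn power_mult_distrib mult_ac)
    qed
    have summ: "summable (\<lambda>n. norm (u n))"
    proof -
      have "summable (\<lambda>n. norm (fps_nth (fps_binomial (-a)) n * (-z) ^ n))"
        using z by (intro norm_summable_fps) (auto simp: fps_conv_radius_binomial)
      then show ?thesis
        by (simp add: u_def gbinomial_pochhammer norm_mult norm_divide norm_power)
    qed
    have "bounded (w ` {0..1})"
      by (intro compact_imp_bounded compact_continuous_image continuous_intros) auto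
    then obtain W where W: "\<And>t. t \<in> {0..1} \<Longrightarrow> norm (w t) \<le> W"
      unfolding bounded_iff by blast
    have "uniform_limit {0..1} (\<lambda>N t. \<Sum>n<N. of_real (w t) * (u n * of_real t ^ n))
             (\<lambda>t. \<Sum>n. of_real (w t) * (u n * of_real t ^ n)) sequentially"
    proof (rule Weierstrass_m_test)
      fix n and t :: real assume t: "t \<in> {0..1}"
      have "norm (of_real (w t) * (u n * of_real t ^ n)) = norm (w t) * norm (u n) * t ^ n"
        using t by (simp add: norm_mult norm_power)
      also have "\<dots> \<le> W * norm (u n) * 1"
        using t W[OF t] norm_ge_zero[of "w t"]
        by (intro mult_mono power_le_one) (auto intro: order_trans[of 0 "norm (w t)" W])
      finally show "norm (of_real (w t) * (u n * of_real t ^ n)) \<le> W * norm (u n)" by simp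
    next
      show "summable (\<lambda>n. W * norm (u n))"
        by (intro summable_mult summ)
    qed
    moreover have "(\<Sum>n. of_real (w t) * (u n * of_real t ^ n)) = of_real (w t) * (1 - of_real t * z) powr (-a)"
      if "t \<in> {0..1}" for t
      using u[OF that] by (intro sums_unique [symmetric] sums_mult)
    ultimately have "uniform_limit {0..1} (\<lambda>N t. \<Sum>n<N. of_real (w t) * (u n * of_real t ^ n))
             (\<lambda>t. of_real (w t) * (1 - of_real t * z) powr (-a)) sequentially"
      by (subst (asm) uniform_limit_cong') auto
    moreover have "continuous_on {0..1} (\<lambda>t. \<Sum>n<N. complex_of_real (w t) * (u n * of_real t ^ n))" for N
      by (intro continuous_intros) auto
    ultimately obtain I J where
      I: "\<And>N. ((\<lambda>t. \<Sum>n<N. of_real (w t) * (u n * of_real t ^ n)) has_integral I N) {0..1}" and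
      J: "((\<lambda>t. of_real (w t) * (1 - of_real t * z) powr (-a)) has_integral J) {0..1}" and
      IJ: "I \<longlonglongrightarrow> J"
      by (rule uniform_limit_integral) auto
    have FJ: "F z = J"
      using J by (simp add: F_def integral_unique)
    have "I N = (\<Sum>n<N. u n * of_real (Beta b d * pochhammer b n / pochhammer (b + d) n))" for N
    proof (rule has_integral_unique[OF I])
      have "((\<lambda>t. \<Sum>n<N. u n * of_real (t ^ n * w t)) has_integral
               (\<Sum>n<N. u n * of_real (Beta b d * pochhammer b n / pochhammer (b + d) n))) {0..1}"
        unfolding w_def using b d
        by (intro has_integral_sum has_integral_mult_right has_integral_of_real has_integral_Beta_moment) auto
      then show "((\<lambda>t. \<Sum>n<N. of_real (w t) * (u n * of_real t ^ n)) has_integral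
               (\<Sum>n<N. u n * of_real (Beta b d * pochhammer b n / pochhammer (b + d) n))) {0..1}"
        by (simp add: mult_ac)
    qed
    then have "(\<lambda>n. u n * of_real (Beta b d * pochhammer b n / pochhammer (b + d) n)) sums F z"
      using IJ unfolding FJ sums_def by (subst filterlim_cong[OF refl refl always_eventually]) auto
    then have "(\<lambda>n. u n * of_real (Beta b d * pochhammer b n / pochhammer (b + d) n) / of_real (Beta b d)) sums
        (F z / of_real (Beta b d))"
      by (rule sums_divide)
    moreover have "Beta b d > 0"
      using b d by (simp add: Beta_def Gamma_real_pos)
    ultimately show ?thesis
      by (simp add: u_def pochhammer_of_real mult_ac flip: of_real_add)
  qed
  have "(\<lambda>z. F z / of_real (Beta b d)) has_fps_expansion fps_hypergeo [a, of_real b] [of_real (b + d)] 1"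
  proof (rule has_fps_expansionI)
    have "eventually (\<lambda>z :: complex. z \<in> ball 0 1) (nhds 0)"
      by (intro eventually_nhds_in_open) auto
    then show "\<forall>\<^sub>F z in nhds 0. (\<lambda>n. fps_nth (fps_hypergeo [a, of_real b] [of_real (b + d)] 1) n * z ^ n) sums
        (F z / of_real (Beta b d))"
      by eventually_elim (use sums in auto)
  qed
  moreover have "(\<lambda>z. F z / of_real (Beta b d)) holomorphic_on slit_plane"
    using b d by (intro holomorphic_intros holo) (auto simp: Beta_def Gamma_real_pos less_imp_neq[symmetric])
  ultimately show ?thesis
    unfolding continues_to_slit_plane_def by blast
qed

text \<open>Contiguous relation \<open>F(a, b; c) = F(a, b + 1; c) - (a / c) z F(a + 1, b + 1; c + 1)\<close>.\<close>
lemma continues_lower_b: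
  assumes c: "\<And>n. pochhammer c n \<noteq> 0"
    and "continues_to_slit_plane a (b + 1) c" "continues_to_slit_plane (a + 1) (b + 1) (c + 1)"
  shows "continues_to_slit_plane a b c"
proof -
  obtain f g where
    f: "f holomorphic_on slit_plane" "f has_fps_expansion fps_hypergeo [a, b + 1] [c] 1" and
    g: "g holomorphic_on slit_plane" "g has_fps_expansion fps_hypergeo [a + 1, b + 1] [c + 1] 1"
    using assms unfolding continues_to_slit_plane_def by blast
  have c0: "c \<noteq> 0" using c[of 1] by simp
  have "fps_hypergeo [a, b + 1] [c] 1 - fps_const (a / c) * (fps_X * fps_hypergeo [a + 1, b + 1] [c + 1] 1) =
          fps_hypergeo [a, b] [c] 1"
  proof (rule fps_ext)
    fix n
    show "fps_nth (fps_hypergeo [a, b + 1] [c] 1 - fps_const (a / c) * (fps_X * fps_hypergeo [a + 1, b + 1] [c + 1] 1)) n =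
          fps_nth (fps_hypergeo [a, b] [c] 1) n"
    proof (cases n)
      case (Suc k)
      define P where "P = pochhammer (c + 1) k"
      have P: "P \<noteq> 0"
        using c[of "Suc k"] by (simp add: P_def pochhammer_rec)
      define A where "A = a * pochhammer (a + 1) k * pochhammer (b + 1) k / (c * P * fact k)"
      have "fps_nth (fps_hypergeo [a, b + 1] [c] 1 - fps_const (a / c) * (fps_X * fps_hypergeo [a + 1, b + 1] [c + 1] 1)) n =
          A * (b + 1 + of_nat k) / of_nat (Suc k) - A"
        unfolding Suc by (simp add: pochhammer_rec[of a] pochhammer_rec[of c] pochhammer_rec'[of "b + 1"] A_def P_def mult_ac)
           (simp add: algebra_simps)
      also have "\<dots> = A * b / of_nat (Suc k)"
        by (simp add: divide_simps del: of_nat_Suc) (simp add: algebra_simps)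
      also have "\<dots> = fps_nth (fps_hypergeo [a, b] [c] 1) n"
        unfolding Suc by (simp add: pochhammer_rec[of a] pochhammer_rec[of b] pochhammer_rec[of c] A_def P_def mult_ac)
           (simp add: algebra_simps)
      finally show ?thesis .
    qed simp
  qed
  moreover have "(\<lambda>z. f z - a / c * (z * g z)) has_fps_expansion
      fps_hypergeo [a, b + 1] [c] 1 - fps_const (a / c) * (fps_X * fps_hypergeo [a + 1, b + 1] [c + 1] 1)"
    by (intro fps_expansion_intros f g)
  moreover have "(\<lambda>z. f z - a / c * (z * g z)) holomorphic_on slit_plane"
    by (intro holomorphic_intros f g)
  ultimately show ?thesis
    unfolding continues_to_slit_plane_def by auto
qed

text \<open>Contiguous relation
\<open>F(a, b; c) = F(a, b; c + 1) + a b / (c (c + 1)) z F(a + 1, b + 1; c + 2)\<close>.\<close>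
lemma continues_lower_c:
  assumes c: "\<And>n. pochhammer c n \<noteq> 0"
    and "continues_to_slit_plane a b (c + 1)" "continues_to_slit_plane (a + 1) (b + 1) (c + 2)"
  shows "continues_to_slit_plane a b c"
proof -
  obtain f g where
    f: "f holomorphic_on slit_plane" "f has_fps_expansion fps_hypergeo [a, b] [c + 1] 1" and
    g: "g holomorphic_on slit_plane" "g has_fps_expansion fps_hypergeo [a + 1, b + 1] [c + 2] 1"
    using assms unfolding continues_to_slit_plane_def by blast
  have c0: "c \<noteq> 0" using c[of 1] by simp
  have "fps_hypergeo [a, b] [c + 1] 1 + fps_const (a * b / (c * (c + 1))) * (fps_X * fps_hypergeo [a + 1, b + 1] [c + 2] 1) =
          fps_hypergeo [a, b] [c] 1"
  proof (rule fps_ext)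
    fix n
    show "fps_nth (fps_hypergeo [a, b] [c + 1] 1 + fps_const (a * b / (c * (c + 1))) * (fps_X * fps_hypergeo [a + 1, b + 1] [c + 2] 1)) n =
          fps_nth (fps_hypergeo [a, b] [c] 1) n"
    proof (cases n)
      case (Suc k)
      define P where "P = pochhammer (c + 1) k"
      have P: "P \<noteq> 0" "c + 1 + of_nat k \<noteq> 0"
        using c[of "Suc k"] c[of "Suc (Suc k)"] unfolding P_def
        by (simp_all only: pochhammer_rec[of c] pochhammer_rec'[of "c + 1"]) auto
      have Q: "(c + 1) * pochhammer (c + 2) k = P * (c + 1 + of_nat k)"
        using pochhammer_rec[of "c + 1" k] pochhammer_rec'[of "c + 1" k] by (simp add: P_def add_ac mult_ac)
      have R: "pochhammer (c + 1) (Suc k) = P * (c + 1 + of_nat k)" "pochhammer c (Suc k) = c * P"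
        by (simp_all add: P_def pochhammer_rec[of c] pochhammer_rec'[of "c + 1"])
      define A where "A = pochhammer (a + 1) k * pochhammer (b + 1) k / fact k"
      have "fps_nth (fps_hypergeo [a, b] [c + 1] 1 + fps_const (a * b / (c * (c + 1))) * (fps_X * fps_hypergeo [a + 1, b + 1] [c + 2] 1)) n =
          a * b * A / (P * (c + 1 + of_nat k) * of_nat (Suc k)) + a * b * A / (c * ((c + 1) * pochhammer (c + 2) k))"
        unfolding Suc by (simp add: R pochhammer_rec[of a] pochhammer_rec[of b] A_def mult_ac)
           (simp add: algebra_simps)
      also have "\<dots> = a * b * A / (c * P * of_nat (Suc k))"
        unfolding Q using P c0 by (simp add: divide_simps del: of_nat_Suc) (simp add: algebra_simps)
      also have "\<dots> = fps_nth (fps_hypergeo [a, b] [c] 1) n"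
        unfolding Suc by (simp add: R pochhammer_rec[of a] pochhammer_rec[of b] A_def mult_ac)
           (simp add: algebra_simps)
      finally show ?thesis .
    qed simp
  qed
  moreover have "(\<lambda>z. f z + a * b / (c * (c + 1)) * (z * g z)) has_fps_expansion
      fps_hypergeo [a, b] [c + 1] 1 + fps_const (a * b / (c * (c + 1))) * (fps_X * fps_hypergeo [a + 1, b + 1] [c + 2] 1)"
    by (intro fps_expansion_intros f g)
  moreover have "(\<lambda>z. f z + a * b / (c * (c + 1)) * (z * g z)) holomorphic_on slit_plane"
    by (intro holomorphic_intros f g)
  ultimately show ?thesis
    unfolding continues_to_slit_plane_def by auto
qed

lemma pochhammer_of_real_pos_nonzero: "c > 0 \<Longrightarrow> pochhammer (complex_of_real c) n \<noteq> 0"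
  using pochhammer_pos[of c n] by (simp add: pochhammer_of_real)

text \<open>Both functions on the right of the second contiguous relation have a larger value of \<open>c - b\<close>, and both on
the right of the first have a larger \<open>b\<close>. So the parameters can be moved into the range of
Euler's integral, first raising \<open>b\<close> and then \<open>c - b\<close>.\<close>
theorem hypergeo_continues_to_slit_plane:
  fixes b c :: real
  assumes c: "c > 0"
  shows "continues_to_slit_plane a (of_real b) (of_real c)"
proof -
  \<comment> \<open>The number \<open>n\<close> of steps bounds how far \<open>c - b\<close>, and further below \<open>b\<close>, is from exceeding 1.\<close>
  have large_b: "continues_to_slit_plane a (of_real b) (of_real c)"
    if "b > 1" "c > 0" "c - b + of_nat n > 1" for a b c n
    using that
  proof (induction n arbitrary: a b c)
    case 0
    then show ?case
      using continues_by_Euler_integral[of b "c - b" a] by simp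
  next
    case (Suc n)
    have "continues_to_slit_plane a (of_real b) (of_real (c + 1))"
      using Suc.prems by (intro Suc.IH) auto
    moreover have "continues_to_slit_plane (a + 1) (of_real (b + 1)) (of_real (c + 2))"
      using Suc.prems by (intro Suc.IH) auto
    ultimately show ?case
      using Suc.prems continues_lower_c[OF pochhammer_of_real_pos_nonzero, of c a "of_real b"] by simp
  qed
  have all_b: "continues_to_slit_plane a (of_real b) (of_real c)" if "c > 0" "b + of_nat n > 1" for a b c n
    using that
  proof (induction n arbitrary: a b c)
    case 0
    obtain n where "of_nat n > 1 - (c - b)"
      using reals_Archimedean2 by blast
    then show ?case
      using 0 by (intro large_b[of b c n]) auto
  next
    case (Suc n)
    have "continues_to_slit_plane a (of_real (b + 1)) (of_real c)"
         "continues_to_slit_plane (a + 1) (of_real (b + 1)) (of_real (c + 1))"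
      using Suc.prems by (intro Suc.IH; simp)+
    then show ?case
      using Suc.prems continues_lower_b[OF pochhammer_of_real_pos_nonzero, of c a "of_real b"] by simp
  qed
  obtain n where "of_nat n > 1 - b"
    using reals_Archimedean2 by blast
  then show ?thesis
    by (intro all_b[OF c, of b n]) simp
qed

lemma
  fixes b c :: real
  assumes c: "c > 0"
  shows gauss_2F1_holomorphic: "gauss_2F1 a (of_real b) (of_real c) holomorphic_on slit_plane"
    and gauss_2F1_has_fps_expansion:
      "gauss_2F1 a (of_real b) (of_real c) has_fps_expansion fps_hypergeo [a, of_real b] [of_real c] 1"
proof -
  obtain f where f: "f holomorphic_on slit_plane" "f has_fps_expansion fps_hypergeo [a, of_real b] [of_real c] 1"
    using hypergeo_continues_to_slit_plane[OF c] unfolding continues_to_slit_plane_def by blast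
  have eq: "gauss_2F1 a (of_real b) (of_real c) z = f z" if "z \<in> slit_plane" for z
  proof (rule gauss_2F1_eqI[OF f(1) _ that])
    fix w :: complex assume "norm w < 1"
    then show "f w = gauss_series a (of_real b) (of_real c) w"
      unfolding gauss_series_def
      by (intro has_fps_expansion_imp_eval_fps_eq[OF f(2), of w 1, symmetric]
            holomorphic_on_subset[OF f(1) ball_subset_slit_plane])
  qed
  then show "gauss_2F1 a (of_real b) (of_real c) holomorphic_on slit_plane"
    using f(1) by (subst holomorphic_cong[OF refl]) auto
  have "0 \<in> slit_plane" using ball_subset_slit_plane by auto
  then have "\<forall>\<^sub>F z in nhds 0. z \<in> slit_plane"
    using open_slit_plane eventually_nhds_in_open by blast
  then have "\<forall>\<^sub>F z in nhds 0. gauss_2F1 a (of_real b) (of_real c) z = f z"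
    by eventually_elim (use eq in auto)
  then show "gauss_2F1 a (of_real b) (of_real c) has_fps_expansion fps_hypergeo [a, of_real b] [of_real c] 1"
    using f(2) by (subst has_fps_expansion_cong) auto
qed

section \<open>Pfaff's and the quadratic transformation near the origin\<close>

text \<open>Because the inner series is \<open>X * B\<close>, its \<open>k\<close>-th power starts in degree \<open>k\<close>, and the coefficient of
the composition is a finite sum in which each power of \<open>B\<close> can be merged with \<open>C\<close>.\<close>
lemma fps_nth_mult_compose_shifted:
  fixes H B C :: "'a :: comm_ring_1 fps"
  shows "fps_nth (C * fps_compose H (fps_X * B)) N = (\<Sum>k\<le>N. fps_nth H k * fps_nth (C * B ^ k) (N - k))"
proof -
  have 1: "fps_nth (fps_compose H (fps_X * B)) l =
             (\<Sum>k\<le>N. fps_nth H k * fps_nth (fps_X ^ k * B ^ k) l)" if "l \<le> N" for l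
  proof -
    have "(\<Sum>k\<le>N. fps_nth H k * fps_nth (fps_X ^ k * B ^ k) l) =
          (\<Sum>k\<in>{0..l}. fps_nth H k * fps_nth (fps_X ^ k * B ^ k) l)"
      using that by (intro sum.mono_neutral_right) (auto simp: fps_X_power_mult_nth)
    then show ?thesis
      by (simp add: fps_compose_nth power_mult_distrib)
  qed
  have "fps_nth (C * fps_compose H (fps_X * B)) N =
          (\<Sum>i=0..N. fps_nth C i * (\<Sum>k\<le>N. fps_nth H k * fps_nth (fps_X ^ k * B ^ k) (N - i)))"
    unfolding fps_mult_nth[of C] by (intro sum.cong refl) (simp add: 1)
  also have "\<dots> = (\<Sum>k\<le>N. fps_nth H k * (\<Sum>i=0..N. fps_nth C i * fps_nth (fps_X ^ k * B ^ k) (N - i)))"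
    unfolding sum_distrib_left by (subst sum.swap) (simp add: mult_ac)
  also have "\<dots> = (\<Sum>k\<le>N. fps_nth H k * fps_nth (fps_X ^ k * (C * B ^ k)) N)"
    by (simp only: fps_mult_nth [symmetric] mult.left_commute)
  also have "\<dots> = (\<Sum>k\<le>N. fps_nth H k * fps_nth (C * B ^ k) (N - k))"
    by (intro sum.cong refl) (auto simp: fps_X_power_mult_nth)
  finally show ?thesis .
qed

text \<open>The common source of Pfaff's transformation (\<open>p = 1\<close>) and of the generating function and the quadratic
transformation (\<open>p = 2\<close>): the powers of \<open>1 + z\<close> that accompany \<open>z\<^bsup>k\<^esup>\<close> combine to
\<open>(1 + z)\<^bsup>-lam-kp\<^esup>\<close>, which the binomial series expands.\<close>
lemma has_fps_expansion_powr_times_compose: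
  fixes lam p y :: complex
  assumes "h has_fps_expansion H"
  shows "(\<lambda>z. (1 + z) powr (-lam) * h (z * (y * (1 + z) powr (-p)))) has_fps_expansion
           Abs_fps (\<lambda>N. \<Sum>k\<le>N. fps_nth H k * y ^ k *
             ((-1) ^ (N - k) * pochhammer (lam + of_nat k * p) (N - k) / fact (N - k)))"
proof -
  define B C where "B = fps_const y * fps_binomial (-p)" and "C = fps_binomial (-lam)"
  have "(\<lambda>z. (1 + z) powr (-lam) * (h \<circ> (\<lambda>z. z * (y * (1 + z) powr (-p)))) z) has_fps_expansion
          C * fps_compose H (fps_X * B)"
    unfolding B_def C_def by (intro fps_expansion_intros assms) auto
  also have "C * fps_compose H (fps_X * B) =
           Abs_fps (\<lambda>N. \<Sum>k\<le>N. fps_nth H k * y ^ k *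
             ((-1) ^ (N - k) * pochhammer (lam + of_nat k * p) (N - k) / fact (N - k)))"
  proof (rule fps_ext, unfold fps_nth_mult_compose_shifted fps_nth_Abs_fps, intro sum.cong refl)
    fix N k :: nat
    have "C * B ^ k = fps_const (y ^ k) * fps_binomial (- (lam + of_nat k * p))"
      by (simp add: B_def C_def power_mult_distrib fps_binomial_power fps_const_power mult.left_commute
               flip: fps_binomial_add_mult)
    then show "fps_nth H k * fps_nth (C * B ^ k) (N - k) = fps_nth H k * y ^ k *
             ((-1) ^ (N - k) * pochhammer (lam + of_nat k * p) (N - k) / fact (N - k))"
      by (simp add: gbinomial_pochhammer add_ac)
  qed
  finally show ?thesis
    by (simp add: o_def)
qed

text \<open>Pfaff's transformation \<open>(1 + z)\<^bsup>-a\<^esup> F(a, c - b; c; z / (1 + z)) = F(a, b; c; -z)\<close>; the coefficients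
on the left are Chu-Vandermonde sums.\<close>
lemma pfaff_expansion:
  fixes a b c :: complex
  assumes c: "\<And>n. pochhammer c n \<noteq> 0"
    and h: "h has_fps_expansion fps_hypergeo [a, c - b] [c] 1"
  shows "(\<lambda>z. (1 + z) powr (-a) * h (z * (1 + z) powr (-1))) has_fps_expansion
           fps_hypergeo [a, b] [c] (-1)"
proof -
  have eq: "(\<Sum>k\<le>N. fps_nth (fps_hypergeo [a, c - b] [c] 1) k *
         ((-1) ^ (N - k) * pochhammer (a + of_nat k) (N - k) / fact (N - k))) =
        fps_nth (fps_hypergeo [a, b] [c] (-1)) N" for N
  proof -
    have "(\<Sum>k\<le>N. fps_nth (fps_hypergeo [a, c - b] [c] 1) k *
            ((-1) ^ (N - k) * pochhammer (a + of_nat k) (N - k) / fact (N - k))) =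
          (\<Sum>k\<le>N. (-1) ^ N * pochhammer a N / fact N *
            (pochhammer (- of_nat N) k * pochhammer (c - b) k / (pochhammer c k * fact k)))"
    proof (rule sum.cong)
      fix k assume "k \<in> {..N}"
      then have k: "k \<le> N" by simp
      have "(-1 :: complex) ^ (N - k) = (-1) ^ N * (-1) ^ k"
        using k by (simp add: minus_one_power_iff)
      then show "fps_nth (fps_hypergeo [a, c - b] [c] 1) k *
            ((-1) ^ (N - k) * pochhammer (a + of_nat k) (N - k) / fact (N - k)) =
          (-1) ^ N * pochhammer a N / fact N *
            (pochhammer (- of_nat N) k * pochhammer (c - b) k / (pochhammer c k * fact k))"
        using pochhammer_product[OF k, of a] by (simp add: pochhammer_neg_of_nat[OF k] mult_ac)
    qed simp
    also have "\<dots> = (-1) ^ N * pochhammer a N / fact N * (pochhammer b N / pochhammer c N)"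
      unfolding sum_distrib_left [symmetric] by (subst chu_vandermonde[OF c]) simp
    finally show ?thesis
      by (simp add: mult_ac)
  qed
  show ?thesis
    using has_fps_expansion_powr_times_compose[OF h, of a 1 1]
    by (simp only: power_one mult_1_right mult_1_left eq fps_nth_inverse)
qed

text \<open>The duplication formula for Pochhammer symbols; the argument 4 absorbs the powers of 2.\<close>
lemma fps_hypergeo_quadratic_nth:
  "fps_nth (fps_hypergeo [lam / 2, (lam + 1) / 2] [c] 4) k =
     pochhammer lam (2 * k) / (pochhammer c k * fact k)" for lam c :: complex
proof -
  have "pochhammer lam (2 * k) = 4 ^ k * (pochhammer (lam / 2) k * pochhammer ((lam + 1) / 2) k)"
    using pochhammer_double[of "lam / 2" k] by (simp add: power_mult add_divide_distrib)
  then show ?thesis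
    by simp
qed

text \<open>The generating function
\<open>(1 + z)\<^bsup>-lam\<^esup> F(lam / 2, (lam + 1) / 2; c; 4 t z / (1 + z)\<^sup>2) = \<Sum> S lam N z\<^bsup>N\<^esup>\<close>, where \<open>h v\<close> stands for
the hypergeometric function at \<open>4 * v\<close>.\<close>
lemma quadratic_generating_function_expansion:
  fixes lam c t :: complex
  assumes "h has_fps_expansion fps_hypergeo [lam / 2, (lam + 1) / 2] [c] 4"
  shows "(\<lambda>z. (1 + z) powr (-lam) * h (z * (t * (1 + z) powr (-2)))) has_fps_expansion
           Abs_fps (scaled_jacobi lam c t)"
proof -
  have "(\<Sum>k\<le>N. fps_nth (fps_hypergeo [lam / 2, (lam + 1) / 2] [c] 4) k * t ^ k *
             ((-1) ^ (N - k) * pochhammer (lam + of_nat k * 2) (N - k) / fact (N - k))) =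
        scaled_jacobi lam c t N" for N
    unfolding scaled_jacobi_altdef
  proof (intro sum.cong refl)
    fix k assume k: "k \<in> {..N}"
    have "pochhammer lam (N + k) = pochhammer lam (2 * k) * pochhammer (lam + of_nat k * 2) (N - k)"
      using pochhammer_product[of "2 * k" "N + k" lam] k by (simp add: mult.commute)
    then show "fps_nth (fps_hypergeo [lam / 2, (lam + 1) / 2] [c] 4) k * t ^ k *
             ((-1) ^ (N - k) * pochhammer (lam + of_nat k * 2) (N - k) / fact (N - k)) =
          (-1) ^ (N - k) * pochhammer lam (N + k) / (fact (N - k) * fact k * pochhammer c k) * t ^ k"
      unfolding fps_hypergeo_quadratic_nth by (simp add: mult_ac)
  qed
  then show ?thesis
    using has_fps_expansion_powr_times_compose[OF assms, of lam t 2] by (simp only:)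
qed

text \<open>At \<open>t = 1\<close> the generating function is itself hypergeometric, which is the quadratic transformation
\<open>F(lam, lam - c + 1; c; z) = (1 + z)\<^bsup>-lam\<^esup> F(lam / 2, (lam + 1) / 2; c; 4 z / (1 + z)\<^sup>2)\<close>.\<close>
lemma quadratic_transformation_expansion:
  fixes lam c :: complex
  assumes c: "\<And>n. pochhammer c n \<noteq> 0"
    and "h has_fps_expansion fps_hypergeo [lam / 2, (lam + 1) / 2] [c] 4"
  shows "(\<lambda>z. (1 + z) powr (-lam) * h (z * (1 + z) powr (-2))) has_fps_expansion
           fps_hypergeo [lam, lam - c + 1] [c] 1"
proof -
  have "Abs_fps (scaled_jacobi lam c 1) = fps_hypergeo [lam, lam - c + 1] [c] 1"
    by (rule fps_ext) (simp add: scaled_jacobi_1[OF c])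
  then show ?thesis
    using quadratic_generating_function_expansion[OF assms(2), of 1] by simp
qed

lemma has_fps_expansion_unique_eventually:
  assumes "f has_fps_expansion F" "g has_fps_expansion F"
  shows "eventually (\<lambda>z. f z = g z) (nhds 0)"
  using assms unfolding has_fps_expansion_def by (auto elim: eventually_elim2)

section \<open>The left-hand side as a holomorphic function of \<rho>\<close>

lemma powr_mult_Re_pos:
  fixes x y s :: complex
  assumes "Re x > 0" "Re y > 0"
  shows "(x * y) powr s = x powr s * y powr s"
proof -
  have nz: "x \<noteq> 0" "y \<noteq> 0" using assms by auto
  have "\<bar>Im (Ln x)\<bar> < pi / 2" "\<bar>Im (Ln y)\<bar> < pi / 2"
    using assms Re_Ln_pos_lt[OF nz(1)] Re_Ln_pos_lt[OF nz(2)] by blast+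
  then have "Ln (x * y) = Ln x + Ln y"
    using nz by (subst Ln_times) auto
  then show ?thesis
    using nz by (simp add: powr_def ring_distribs exp_add)
qed

lemma powr_inverse_Re_pos:
  fixes x s :: complex
  assumes "Re x > 0"
  shows "(1 / x) powr s = x powr (- s)"
proof -
  have "x \<noteq> 0" "Re (1 / x) > 0"
    using assms by (auto simp: Re_divide sum_power2_gt_zero_iff intro!: divide_pos_pos)
  then have "(1 / x) powr s * x powr s = 1"
    using assms by (subst powr_mult_Re_pos [symmetric]) auto
  then show ?thesis
    using \<open>x \<noteq> 0\<close> by (simp add: powr_minus field_simps)
qed

lemma R_fun_sq: "(R_fun \<rho> x)\<^sup>2 = 1 + \<rho>\<^sup>2 - 2 * \<rho> * of_real x"
  by (simp add: R_fun_def)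

text \<open>If the radicand is real, then \<open>\<rho>\<close> is real or \<open>Re \<rho> = x\<close>. In the first case the radicand is at least
\<open>(1 - |\<rho>|)\<^sup>2\<close>, in the second it equals \<open>1 - |\<rho>|\<^sup>2\<close>.\<close>
lemma R_fun_radicand:
  fixes \<rho> :: complex
  assumes "norm \<rho> < 1" "x \<in> {-1..1}"
  shows "1 + \<rho>\<^sup>2 - 2 * \<rho> * of_real x \<notin> \<real>\<^sub>\<le>\<^sub>0"
proof
  define u v where "u = Re \<rho>" and "v = Im \<rho>"
  have uv: "u\<^sup>2 + v\<^sup>2 < 1"
    using assms(1) by (simp add: u_def v_def cmod_def)
  assume "1 + \<rho>\<^sup>2 - 2 * \<rho> * of_real x \<in> \<real>\<^sub>\<le>\<^sub>0"
  then have re: "1 + u\<^sup>2 - v\<^sup>2 - 2 * u * x \<le> 0" and im: "2 * v * (u - x) = 0"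
    by (auto simp: complex_nonpos_Reals_iff u_def v_def power2_eq_square algebra_simps)
  from im consider "v = 0" | "u = x" by auto
  then show False
  proof cases
    case 1
    have "\<bar>u\<bar> < 1"
      using uv 1 by (simp add: abs_square_less_1)
    then have "0 < (1 - \<bar>u\<bar>)\<^sup>2" by simp
    also have "\<dots> = 1 + u\<^sup>2 - 2 * (\<bar>u\<bar> * 1)"
      by (simp add: power2_eq_square algebra_simps)
    also have "\<dots> \<le> 1 + u\<^sup>2 - 2 * (u * x)"
    proof -
      have "u * x \<le> \<bar>u\<bar> * \<bar>x\<bar>" by (metis abs_ge_self abs_mult)
      also have "\<dots> \<le> \<bar>u\<bar> * 1" using assms(2) by (intro mult_left_mono) auto
      finally show ?thesis by simp
    qed
    finally show False using re 1 by simp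
  next
    case 2
    then show False using re uv by (simp add: power2_eq_square)
  qed
qed

lemma Re_one_plus_pos: "norm \<rho> < 1 \<Longrightarrow> Re (1 + \<rho>) > 0"
  using complex_Re_le_cmod[of "-\<rho>"] by simp

context
  fixes x :: real and \<rho> :: complex
  assumes \<rho>: "norm \<rho> < 1" and x: "x \<in> {-1..1}"
begin

lemma Re_R_fun_pos: "Re (R_fun \<rho> x) > 0"
proof (rule ccontr)
  assume "\<not> Re (R_fun \<rho> x) > 0"
  then have "Re (R_fun \<rho> x) = 0"
    using Re_csqrt[of "1 + \<rho>\<^sup>2 - 2 * \<rho> * of_real x"] by (simp add: R_fun_def)
  then have "(R_fun \<rho> x)\<^sup>2 \<in> \<real>\<^sub>\<le>\<^sub>0"
    by (auto simp: complex_nonpos_Reals_iff power2_eq_square)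
  then show False
    using R_fun_radicand[OF \<rho> x] by (simp add: R_fun_sq)
qed

lemma R_fun_nonzero: "R_fun \<rho> x \<noteq> 0"
  using Re_R_fun_pos by auto

lemma Re_q_pos: "Re (1 + \<rho> + R_fun \<rho> x) > 0"
  using Re_one_plus_pos[OF \<rho>] Re_R_fun_pos by simp

text \<open>Otherwise \<open>\<zeta>\<close> would be a negative real number, but it is the quotient of \<open>1 + \<rho>\<close> and \<open>R\<close>, which both
have positive real part.\<close>
lemma zeta_plus_slit_plane: "(1 - zeta_plus \<rho> x) / 2 \<in> slit_plane"
proof (rule ccontr)
  assume "(1 - zeta_plus \<rho> x) / 2 \<notin> slit_plane"
  then obtain s where s: "s \<ge> 1" "(1 - zeta_plus \<rho> x) / 2 = of_real s"
    by (auto simp: slit_plane_def)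
  then have "zeta_plus \<rho> x = of_real (1 - 2 * s)"
    by (simp add: field_simps)
  then have "1 + \<rho> = of_real (1 - 2 * s) * R_fun \<rho> x"
    using R_fun_nonzero by (simp add: zeta_plus_def field_simps)
  then have "Re (1 + \<rho>) = (1 - 2 * s) * Re (R_fun \<rho> x)"
    by (metis Re_complex_of_real Im_complex_of_real times_complex.sel(1) mult_zero_left diff_zero)
  moreover have "(1 - 2 * s) * Re (R_fun \<rho> x) \<le> 0"
    using s Re_R_fun_pos by (intro mult_nonpos_nonneg) auto
  ultimately show False
    using Re_one_plus_pos[OF \<rho>] by linarith
qed

end

text \<open>The left-hand side of the theorem without the factor \<open>common_factor\<close> defined below, with \<open>\<nu>\<close> in place of
\<open>\<alpha> + m\<close>. Unlike \<open>gen_fun\<close> it has no singularity on \<open>(-1, 0]\<close> or at \<open>x = -1\<close>.\<close>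
definition reduced_gen_fun :: "real \<Rightarrow> real \<Rightarrow> real \<Rightarrow> complex \<Rightarrow> complex" where
  "reduced_gen_fun \<nu> \<beta> x \<rho> =
     (2 / (1 + \<rho> + R_fun \<rho> x)) powr of_real \<beta> * R_fun \<rho> x powr of_real (- (\<nu> + 1)) *
     gauss_2F1 (of_real (-\<nu>)) (of_real (\<nu> + 1)) (of_real (\<beta> + 1)) ((1 - zeta_plus \<rho> x) / 2)"

lemma not_nonpos_if_Re_pos: "Re z > 0 \<Longrightarrow> z \<notin> \<real>\<^sub>\<le>\<^sub>0"
  by (auto simp: complex_nonpos_Reals_iff)

lemma Re_divide_pos: "Re z > 0 \<Longrightarrow> r > 0 \<Longrightarrow> Re (of_real r / z) > 0"
  by (auto simp: Re_divide intro!: divide_pos_pos add_pos_nonneg)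

lemma R_fun_holomorphic:
  assumes x: "x \<in> {-1..1}"
  shows "(\<lambda>\<rho>. R_fun \<rho> x) holomorphic_on ball 0 1"
  unfolding R_fun_def using R_fun_radicand[OF _ x] by (intro holomorphic_intros) auto

lemma reduced_gen_fun_holomorphic:
  assumes x: "x \<in> {-1..1}" and \<beta>: "\<beta> > -1"
  shows "reduced_gen_fun \<nu> \<beta> x holomorphic_on ball 0 1"
proof -
  note R = R_fun_holomorphic[OF x]
  have q: "2 / (1 + \<rho> + R_fun \<rho> x) \<notin> \<real>\<^sub>\<le>\<^sub>0" if "norm \<rho> < 1" for \<rho>
    using Re_divide_pos[OF Re_q_pos[OF that x], of 2] by (intro not_nonpos_if_Re_pos) simp
  have z: "(\<lambda>\<rho>. (1 - zeta_plus \<rho> x) / 2) holomorphic_on ball 0 1"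
    unfolding zeta_plus_def using R_fun_nonzero[OF _ x] by (intro holomorphic_intros R) auto
  have "(gauss_2F1 (of_real (-\<nu>)) (of_real (\<nu> + 1)) (of_real (\<beta> + 1)) \<circ> (\<lambda>\<rho>. (1 - zeta_plus \<rho> x) / 2)) holomorphic_on ball 0 1"
    using zeta_plus_slit_plane[OF _ x] \<beta>
    by (intro holomorphic_on_compose_gen[OF z gauss_2F1_holomorphic]) auto
  moreover have "1 + \<rho> + R_fun \<rho> x \<noteq> 0" if "norm \<rho> < 1" for \<rho>
    using Re_q_pos[OF that x] by (metis less_irrefl zero_complex.sel(1))
  ultimately show ?thesis
    unfolding reduced_gen_fun_def o_def using q not_nonpos_if_Re_pos[OF Re_R_fun_pos[OF _ x]]
    by (intro holomorphic_intros R) auto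
qed

text \<open>With \<open>z = (1 + \<rho> - R) / (2 R)\<close> and \<open>w = (1 + \<rho> - R) / q\<close> one has \<open>w = z / (1 + z)\<close>, so Pfaff's
transformation passes from \<open>F(-\<nu>, \<nu> + 1; c; -z)\<close> to \<open>F(\<nu> + 1, lam; c; w)\<close>, and the quadratic
transformation goes on to \<open>w / (1 + w)\<^sup>2 = \<rho> t / (1 + \<rho>)\<^sup>2\<close>. Both \<open>z\<close> and \<open>w\<close> vanish at \<open>\<rho> = 0\<close>, so
it suffices to know the transformations near the origin.\<close>
lemma reduced_gen_fun_has_fps_expansion:
  assumes x: "x \<in> {-1..1}" and \<beta>: "\<beta> > -1"
  shows "reduced_gen_fun \<nu> \<beta> x has_fps_expansion
           Abs_fps (scaled_jacobi (of_real (\<nu> + \<beta> + 1)) (of_real (\<beta> + 1)) ((1 + of_real x) / 2))"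
proof -
  define lam c where "lam = \<nu> + \<beta> + 1" and "c = \<beta> + 1"
  define t where "t = (1 + complex_of_real x) / 2"
  have "c > 0"
    using \<beta> by (simp add: c_def)
  then have c: "c > 0" "pochhammer (complex_of_real c) n \<noteq> 0" for n
    by (auto intro!: pochhammer_of_real_pos_nonzero)
  define h where "h = (\<lambda>v. gauss_2F1 (of_real (lam / 2)) (of_real ((lam + 1) / 2)) (of_real c) (4 * v))"
  have h: "h has_fps_expansion fps_hypergeo [of_real lam / 2, (of_real lam + 1) / 2] [of_real c] 4"
  proof -
    have "(gauss_2F1 (of_real (lam / 2)) (of_real ((lam + 1) / 2)) (of_real c) \<circ> (\<lambda>v. 4 * v)) has_fps_expansion
        fps_compose (fps_hypergeo [of_real (lam / 2), of_real ((lam + 1) / 2)] [of_real c] 1) (fps_const 4 * fps_X)"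
      using c by (intro has_fps_expansion_compose gauss_2F1_has_fps_expansion fps_expansion_intros) auto
    also have "fps_compose (fps_hypergeo [of_real (lam / 2), of_real ((lam + 1) / 2)] [of_real c] 1) (fps_const 4 * fps_X) =
        fps_hypergeo [of_real lam / 2, (of_real lam + 1) / 2] [of_real c] (4 :: complex)"
      unfolding fps_compose_linear by (rule fps_ext) (simp add: mult_ac)
    finally show ?thesis
      by (simp add: h_def o_def)
  qed
  define F where "F = gauss_2F1 (of_real (\<nu> + 1)) (of_real lam) (of_real c)"
  have F: "F has_fps_expansion fps_hypergeo [of_real (\<nu> + 1), of_real lam] [of_real c] 1"
    unfolding F_def by (intro gauss_2F1_has_fps_expansion c)
  define G where "G = (\<lambda>z. gauss_2F1 (of_real (- \<nu>)) (of_real (\<nu> + 1)) (of_real c) (- z))"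
  have G: "G has_fps_expansion fps_hypergeo [of_real (\<nu> + 1), of_real (- \<nu>)] [of_real c] (-1)"
  proof -
    have "(gauss_2F1 (of_real (- \<nu>)) (of_real (\<nu> + 1)) (of_real c) \<circ> (\<lambda>v. (-1) * v)) has_fps_expansion
        fps_compose (fps_hypergeo [of_real (- \<nu>), of_real (\<nu> + 1)] [of_real c] 1) (fps_const (-1) * fps_X)"
      using c by (intro has_fps_expansion_compose gauss_2F1_has_fps_expansion fps_expansion_intros) auto
    also have "fps_compose (fps_hypergeo [of_real (- \<nu>), of_real (\<nu> + 1)] [of_real c] 1) (fps_const (-1) * fps_X) =
        fps_hypergeo [of_real (\<nu> + 1), of_real (- \<nu>)] [of_real c] (-1 :: complex)"
      unfolding fps_compose_linear by (rule fps_ext) (simp add: mult_ac)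
    finally show ?thesis
      by (simp add: G_def o_def)
  qed
  have quadratic: "\<forall>\<^sub>F w in nhds 0. (1 + w) powr (- of_real lam) * h (w * (1 + w) powr (-2)) = F w"
  proof (rule has_fps_expansion_unique_eventually)
    have "of_real lam - of_real c + 1 = (of_real (\<nu> + 1) :: complex)"
      by (simp add: lam_def c_def)
    moreover have "fps_hypergeo [of_real lam, of_real (\<nu> + 1)] [of_real c] 1 =
                   fps_hypergeo [of_real (\<nu> + 1), of_real lam] [of_real c] (1 :: complex)"
      by (rule fps_ext) simp
    ultimately show "(\<lambda>w. (1 + w) powr (- of_real lam) * h (w * (1 + w) powr (-2))) has_fps_expansion
        fps_hypergeo [of_real (\<nu> + 1), of_real lam] [of_real c] 1"
      using quadratic_transformation_expansion[OF c(2) h] by simp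
  qed (rule F)
  have pfaff: "\<forall>\<^sub>F z in nhds 0. (1 + z) powr (- of_real (\<nu> + 1)) * F (z * (1 + z) powr (-1)) = G z"
  proof (rule has_fps_expansion_unique_eventually)
    have "of_real c - of_real (- \<nu>) = (of_real lam :: complex)"
      by (simp add: lam_def c_def)
    then show "(\<lambda>z. (1 + z) powr (- of_real (\<nu> + 1)) * F (z * (1 + z) powr (-1))) has_fps_expansion
        fps_hypergeo [of_real (\<nu> + 1), of_real (- \<nu>)] [of_real c] (-1)"
      using pfaff_expansion[OF c(2), of F "of_real (\<nu> + 1)" "of_real (- \<nu>)"] F by simp
  qed (rule G)
  define w where "w = (\<lambda>\<rho>. (1 + \<rho> - R_fun \<rho> x) / (1 + \<rho> + R_fun \<rho> x))"
  define z where "z = (\<lambda>\<rho>. (1 + \<rho> - R_fun \<rho> x) / (2 * R_fun \<rho> x))"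
  have R0: "((\<lambda>\<rho>. R_fun \<rho> x) \<longlongrightarrow> 1) (nhds 0)"
  proof -
    have "isCont (\<lambda>\<rho>. R_fun \<rho> x) 0"
      using holomorphic_on_imp_continuous_on[OF R_fun_holomorphic[OF x]]
      by (simp add: continuous_on_eq_continuous_at)
    then show ?thesis
      by (simp add: isCont_def tendsto_nhds_iff R_fun_def)
  qed
  have id0: "((\<lambda>\<rho>. \<rho>) \<longlongrightarrow> 0) (nhds (0 :: complex))"
    by (simp add: filterlim_ident)
  have "(w \<longlongrightarrow> 0) (nhds 0)" "(z \<longlongrightarrow> 0) (nhds 0)"
    unfolding w_def z_def by (rule tendsto_eq_intros R0 id0 refl | simp)+
  then have "\<forall>\<^sub>F \<rho> in nhds 0. (1 + w \<rho>) powr (- of_real lam) * h (w \<rho> * (1 + w \<rho>) powr (-2)) = F (w \<rho>)"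
      "\<forall>\<^sub>F \<rho> in nhds 0. (1 + z \<rho>) powr (- of_real (\<nu> + 1)) * F (z \<rho> * (1 + z \<rho>) powr (-1)) = G (z \<rho>)"
    using quadratic pfaff by (auto intro: eventually_compose_filterlim)
  moreover have "\<forall>\<^sub>F \<rho> in nhds 0. \<rho> \<in> ball 0 (1 :: real)"
    by (intro eventually_nhds_in_open) auto
  ultimately have "\<forall>\<^sub>F \<rho> in nhds 0. reduced_gen_fun \<nu> \<beta> x \<rho> =
      (1 + \<rho>) powr (- of_real lam) * h (\<rho> * (t * (1 + \<rho>) powr (-2)))"
  proof eventually_elim
    case (elim \<rho>)
    define R q where "R = R_fun \<rho> x" and "q = 1 + \<rho> + R"
    have \<rho>: "norm \<rho> < 1" using elim by simp
    have pos: "Re (1 + \<rho>) > 0" "Re R > 0" "Re q > 0"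
      using Re_one_plus_pos[OF \<rho>] Re_R_fun_pos[OF \<rho> x] Re_q_pos[OF \<rho> x] by (auto simp: R_def q_def)
    then have nz: "1 + \<rho> \<noteq> 0" "R \<noteq> 0" "q \<noteq> 0"
      by (metis less_irrefl zero_complex.sel(1))+
    have pos': "Re (2 / q) > 0" "Re (1 / R) > 0" "Re (q / 2) > 0"
      using Re_divide_pos[OF pos(3), of 2] Re_divide_pos[OF pos(2), of 1] pos(3) by auto
    have w1: "1 + w \<rho> = 2 / q * (1 + \<rho>)" and z1: "1 + z \<rho> = q / 2 * (1 / R)"
      using nz by (auto simp: w_def z_def q_def R_def field_simps)
    have nz': "1 + w \<rho> \<noteq> 0" "1 + z \<rho> \<noteq> 0"
      using nz by (simp_all only: w1 z1 mult_eq_0_iff divide_eq_0_iff) auto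
    have zw: "z \<rho> * (1 + z \<rho>) powr (-1) = w \<rho>"
    proof -
      have "z \<rho> * (1 + z \<rho>) powr (-1) = z \<rho> / (1 + z \<rho>)"
        using nz' by (simp add: powr_minus divide_inverse)
      also have "\<dots> = (1 + \<rho> - R) / (2 * R) / (q / 2 * (1 / R))"
        unfolding z1 by (simp add: z_def R_def)
      also have "\<dots> = (1 + \<rho> - R) / q"
        using nz by simp
      finally show ?thesis
        by (simp add: w_def R_def q_def)
    qed
    have Rsq: "R\<^sup>2 = 1 + \<rho>\<^sup>2 - 2 * \<rho> * of_real x"
      by (simp add: R_def R_fun_sq)
    \<comment> \<open>The relation that removes the square root from \<open>w / (1 + w)\<^sup>2\<close>.\<close>
    have key: "(1 + \<rho> - R) * q = 4 * \<rho> * t"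
    proof -
      have "(1 + \<rho> - R) * q = (1 + \<rho>)\<^sup>2 - R\<^sup>2"
        by (simp add: q_def power2_eq_square algebra_simps)
      also have "\<dots> = 4 * \<rho> * t"
        unfolding Rsq by (simp add: t_def power2_eq_square algebra_simps)
      finally show ?thesis .
    qed
    have wt: "w \<rho> * (1 + w \<rho>) powr (-2) = \<rho> * (t * (1 + \<rho>) powr (-2))"
    proof -
      have "w \<rho> * (1 + w \<rho>) powr (-2) = w \<rho> / (1 + w \<rho>)\<^sup>2"
        using nz' by (simp add: powr_minus divide_inverse)
      also have "\<dots> = (1 + \<rho> - R) * q / (4 * (1 + \<rho>)\<^sup>2)"
      proof -
        have "D / q / (2 / q * E)\<^sup>2 = D * q / (4 * E\<^sup>2)" for D E
          using nz by (simp add: power2_eq_square)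
        moreover have "w \<rho> = (1 + \<rho> - R) / q"
          by (simp add: w_def R_def q_def)
        ultimately show ?thesis
          unfolding w1 by (simp only:)
      qed
      also have "\<dots> = \<rho> * t / (1 + \<rho>)\<^sup>2"
        unfolding key by simp
      also have "\<dots> = \<rho> * (t * (1 + \<rho>) powr (-2))"
        using nz by (simp add: powr_minus divide_inverse)
      finally show ?thesis .
    qed
    have "gauss_2F1 (of_real (-\<nu>)) (of_real (\<nu> + 1)) (of_real (\<beta> + 1)) ((1 - zeta_plus \<rho> x) / 2) = G (z \<rho>)"
    proof -
      have "- z \<rho> = (1 - zeta_plus \<rho> x) / 2"
        using nz by (simp add: z_def zeta_plus_def R_def field_simps)
      then show ?thesis unfolding G_def c_def by (simp only:)
    qed
    also have "\<dots> = (1 + z \<rho>) powr (- of_real (\<nu> + 1)) *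
        ((1 + w \<rho>) powr (- of_real lam) * h (\<rho> * (t * (1 + \<rho>) powr (-2))))"
      using elim(1,2) unfolding zw wt by simp
    finally have "reduced_gen_fun \<nu> \<beta> x \<rho> = (2 / q) powr of_real \<beta> * R powr (- of_real (\<nu> + 1)) *
        ((1 + z \<rho>) powr (- of_real (\<nu> + 1)) *
        ((1 + w \<rho>) powr (- of_real lam) * h (\<rho> * (t * (1 + \<rho>) powr (-2)))))"
      by (simp add: reduced_gen_fun_def R_def q_def)
    also have "(1 + z \<rho>) powr (- of_real (\<nu> + 1)) = (2 / q) powr (of_real (\<nu> + 1)) * R powr (of_real (\<nu> + 1))"
      unfolding z1 using powr_mult_Re_pos[OF pos'(3,2), of "- of_real (\<nu> + 1)"]
        powr_inverse_Re_pos[OF pos(2), of "- of_real (\<nu> + 1)"] powr_inverse_Re_pos[OF pos'(3), of "of_real (\<nu> + 1)"]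
      by (simp add: add.commute)
    also have "(1 + w \<rho>) powr (- of_real lam) = (2 / q) powr (- of_real lam) * (1 + \<rho>) powr (- of_real lam)"
      unfolding w1 using powr_mult_Re_pos[OF pos'(1) pos(1)] .
    also have "(2 / q) powr of_real \<beta> * R powr (- of_real (\<nu> + 1)) *
        ((2 / q) powr (of_real (\<nu> + 1)) * R powr (of_real (\<nu> + 1)) *
        ((2 / q) powr (- of_real lam) * (1 + \<rho>) powr (- of_real lam) * h (\<rho> * (t * (1 + \<rho>) powr (-2))))) =
        ((2 / q) powr of_real \<beta> * (2 / q) powr (of_real (\<nu> + 1)) * (2 / q) powr (- of_real lam)) *
        (R powr (- of_real (\<nu> + 1)) * R powr (of_real (\<nu> + 1))) *
        ((1 + \<rho>) powr (- of_real lam) * h (\<rho> * (t * (1 + \<rho>) powr (-2))))"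
      by (simp only: mult_ac)
    also have "R powr (- of_real (\<nu> + 1)) * R powr (of_real (\<nu> + 1)) = 1"
      using nz by (simp flip: powr_add)
    also have "(2 / q) powr of_real \<beta> * (2 / q) powr (of_real (\<nu> + 1)) * (2 / q) powr (- of_real lam) = 1"
      using nz by (simp add: lam_def flip: powr_add)
    finally show ?case by simp
  qed
  then show ?thesis
    using quadratic_generating_function_expansion[OF h, of t] unfolding lam_def c_def t_def
    by (subst has_fps_expansion_cong) auto
qed

text \<open>Holomorphy in the unit disc carries the expansion from a neighbourhood of 0 to the whole disc.\<close>
lemma reduced_gen_fun_sums:
  assumes x: "x \<in> {-1..1}" and \<beta>: "\<beta> > -1" and \<rho>: "norm \<rho> < 1"
  shows "(\<lambda>N. scaled_jacobi (of_real (\<nu> + \<beta> + 1)) (of_real (\<beta> + 1)) ((1 + of_real x) / 2) N * \<rho> ^ N) sums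
           reduced_gen_fun \<nu> \<beta> x \<rho>"
  using has_fps_expansion_imp_sums_complex[OF reduced_gen_fun_has_fps_expansion[OF x \<beta>], of \<nu> 1 \<rho>]
    reduced_gen_fun_holomorphic[OF x \<beta>] \<rho> by (simp add: one_ereal_def)

section \<open>Rearranging an absolutely convergent double series\<close>

lemma tendsto_linear_ratio:
  fixes p q r :: real
  assumes "q > 0"
  shows "(\<lambda>n. (p + q * real n) / (r + q * real n)) \<longlonglongrightarrow> 1"
proof -
  have top: "filterlim (\<lambda>n. r + q * real n) at_top sequentially"
    by (intro filterlim_tendsto_add_at_top[OF tendsto_const]
          filterlim_tendsto_pos_mult_at_top[OF tendsto_const assms filterlim_real_sequentially])
  have "(\<lambda>n. 1 + (p - r) / (r + q * real n)) \<longlonglongrightarrow> 1 + 0"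
    by (intro tendsto_intros tendsto_divide_0[OF tendsto_const] filterlim_at_top_imp_at_infinity top)
  moreover have "\<forall>\<^sub>F n in sequentially. 1 + (p - r) / (r + q * real n) = (p + q * real n) / (r + q * real n)"
    using filterlim_at_top_dense[THEN iffD1, OF top, rule_format, of 0]
    by eventually_elim (simp add: field_simps)
  ultimately show ?thesis
    using filterlim_cong[OF refl refl] by (simp add: tendsto_cong)
qed

text \<open>The sequence \<open>|f n| * s\<^bsup>n\<^esup>\<close> is eventually decreasing. Zero terms are allowed, which is convenient for
\<open>(m)\<^sub>j\<close> with \<open>m = 0\<close>.\<close>
lemma geometric_bound_if_ratio_tendsto_1:
  fixes f r :: "nat \<Rightarrow> real"
  assumes rec: "\<And>n. f (Suc n) = r n * f n" and lim: "r \<longlonglongrightarrow> 1" and s: "0 < s" "s < 1"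
  shows "\<exists>C. \<forall>n. \<bar>f n\<bar> * s ^ n \<le> C"
proof -
  have "(\<lambda>n. \<bar>r n\<bar> * s) \<longlonglongrightarrow> \<bar>1\<bar> * s"
    by (intro tendsto_intros lim)
  then have "\<forall>\<^sub>F n in sequentially. \<bar>r n\<bar> * s < 1"
    using s by (intro order_tendstoD) auto
  then obtain N where N: "\<bar>r n\<bar> * s \<le> 1" if "n \<ge> N" for n
    unfolding eventually_sequentially by (meson less_imp_le)
  have dec: "\<bar>f n\<bar> * s ^ n \<le> \<bar>f N\<bar> * s ^ N" if "n \<ge> N" for n
    using that
  proof (induction n rule: dec_induct)
    case (step n)
    have "\<bar>f (Suc n)\<bar> * s ^ Suc n = (\<bar>r n\<bar> * s) * (\<bar>f n\<bar> * s ^ n)"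
      by (simp add: rec abs_mult)
    also have "\<dots> \<le> 1 * (\<bar>f n\<bar> * s ^ n)"
      using N[OF step(1)] s by (intro mult_right_mono) auto
    finally show ?case using step.IH by simp
  qed auto
  define C where "C = Max ((\<lambda>n. \<bar>f n\<bar> * s ^ n) ` {..N})"
  have C: "\<bar>f n\<bar> * s ^ n \<le> C" if "n \<le> N" for n
    unfolding C_def using that by (intro Max_ge) auto
  have "\<bar>f n\<bar> * s ^ n \<le> C" for n
    using C[of n] C[of N] dec[of n] by (cases "n \<le> N") auto
  then show ?thesis by blast
qed

lemma sums_rearrange_diagonals:
  fixes u :: "nat \<Rightarrow> nat \<Rightarrow> complex"
  assumes bound: "\<And>n j. norm (u n j) \<le> C * (x ^ n * y ^ j)"
    and xy: "0 \<le> x" "x < 1" "0 \<le> y" "y < 1"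
    and rows: "\<And>n. u n sums g n"
    and diagonals: "(\<lambda>N. \<Sum>n\<le>N. u n (N - n)) sums S"
  shows "g sums S"
proof -
  have geom: "((\<lambda>j. z ^ j) has_sum (1 / (1 - z))) UNIV" if "0 \<le> z" "z < 1" for z :: real
    using that by (intro norm_summable_imp_has_sum geometric_sums) (auto simp: norm_power intro!: summable_geometric)
  have row: "((\<lambda>j. C * (x ^ n * y ^ j)) has_sum (C * (1 / (1 - y)) * x ^ n)) UNIV" for n
    using has_sum_cmult_right[OF geom[OF xy(3,4)], of "C * x ^ n"] by (simp add: mult_ac)
  have "C \<ge> 0"
    using bound[of 0 0] norm_ge_zero[of "u 0 0"] by (simp del: norm_ge_zero)
  then have "(\<lambda>(n, j). C * (x ^ n * y ^ j)) summable_on UNIV \<times> UNIV"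
    using row xy has_sum_cmult_right[OF geom[OF xy(1,2)], of "C * (1 / (1 - y))"]
    by (intro summable_on_SigmaI[where g = "\<lambda>n. C * (1 / (1 - y)) * x ^ n"]) (auto simp: summable_on_def)
  then have "(\<lambda>p. norm (case p of (n, j) \<Rightarrow> u n j)) summable_on UNIV \<times> UNIV"
    by (rule Infinite_Sum.abs_summable_on_comparison_test') (use bound in auto)
  then obtain T where T: "((\<lambda>(n, j). u n j) has_sum T) (UNIV \<times> UNIV)"
    using abs_summable_summable unfolding summable_on_def by blast
  have "(u n has_sum g n) UNIV" for n
  proof (rule norm_summable_imp_has_sum[OF _ rows])
    show "summable (\<lambda>j. norm (u n j))"
    proof (rule summable_comparison_test)
      show "summable (\<lambda>j. C * (x ^ n * y ^ j))"
        using xy by (intro summable_mult summable_geometric) auto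
      show "\<exists>N. \<forall>j\<ge>N. norm (norm (u n j)) \<le> C * (x ^ n * y ^ j)"
        using bound by auto
    qed
  qed
  then have "(g has_sum T) UNIV"
    by (intro has_sum_SigmaD[OF T]) auto
  then have "g sums T"
    by (rule has_sum_imp_sums)
  have "((\<lambda>(N, n). u n (N - n)) has_sum T) (SIGMA N:UNIV. {..N})"
    using T by (rule has_sum_reindex_bij_witness[of _ "\<lambda>(N, n). (n, N - n)" "\<lambda>(n, j). (n + j, n)", THEN iffD1, rotated -1])
      auto
  then have "((\<lambda>N. \<Sum>n\<le>N. u n (N - n)) has_sum T) UNIV"
    by (rule has_sum_SigmaD) (auto intro: has_sum_finiteI)
  then have "(\<lambda>N. \<Sum>n\<le>N. u n (N - n)) sums T"
    by (rule has_sum_imp_sums)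
  then have "T = S"
    using diagonals sums_unique2 by blast
  with \<open>g sums T\<close> show ?thesis by simp
qed

text \<open>The terms of a convergent series are bounded. The series is the generating function at \<open>\<rho> = s\<close>, with the
degree \<open>\<nu> = a - \<beta> - 1\<close> chosen such that \<open>lam = a\<close>.\<close>
lemma scaled_jacobi_bound:
  assumes x: "x \<in> {-1..1}" and \<beta>: "\<beta> > -1" and s: "0 < s" "s < 1"
  shows "\<exists>C. \<forall>n. norm (scaled_jacobi (of_real a) (of_real (\<beta> + 1)) ((1 + of_real x) / 2) n) * s ^ n \<le> C"
proof -
  have "norm (complex_of_real s) < 1" using s by simp
  from reduced_gen_fun_sums[OF x \<beta> this, of "a - \<beta> - 1"]
  have "summable (\<lambda>n. scaled_jacobi (of_real a) (of_real (\<beta> + 1)) ((1 + of_real x) / 2) n * of_real s ^ n)"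
    by (simp add: sums_iff)
  then have "Bseq (\<lambda>n. scaled_jacobi (of_real a) (of_real (\<beta> + 1)) ((1 + of_real x) / 2) n * of_real s ^ n)"
    by (rule summable_imp_Bseq)
  then show ?thesis
    using s by (auto simp: Bseq_def norm_mult norm_power intro: exI)
qed

text \<open>Each of the three factors is a sequence whose consecutive quotients tend to 1, in the indices \<open>n\<close>, \<open>j\<close> and
\<open>2 * n + j\<close> respectively.\<close>
lemma connection_coefficients_bound:
  fixes a s :: real
  assumes a: "\<And>i. a + of_nat i \<noteq> 0" and s: "0 < s" "s < 1"
  shows "\<exists>C. \<forall>n j. \<bar>(2 * of_nat n + a) * (pochhammer (of_nat m) j / fact j) *
           (pochhammer (a + of_nat m) (2 * n + j) / pochhammer a (2 * n + j + 1))\<bar> *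
           (s ^ n * s ^ j * s ^ (2 * n + j)) \<le> C"
proof -
  have nz: "pochhammer a k \<noteq> 0" for k
    using a by (metis pochhammer_eq_0_iff add.commute add_uminus_conv_diff diff_self)
  obtain C1 where C1: "\<And>n. \<bar>2 * of_nat n + a\<bar> * s ^ n \<le> C1"
  proof -
    have "\<exists>C. \<forall>n. \<bar>2 * of_nat n + a\<bar> * s ^ n \<le> C"
    proof (rule geometric_bound_if_ratio_tendsto_1[OF _ tendsto_linear_ratio s])
      show "2 * real (Suc n) + a = (2 + a + 2 * real n) / (a + 2 * real n) * (2 * real n + a)" for n
        using a[of "2 * n"] by (simp add: add_ac)
    qed simp
    then show ?thesis using that by blast
  qed
  obtain C2 where C2: "\<And>j. \<bar>pochhammer (real m) j / fact j\<bar> * s ^ j \<le> C2"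
  proof -
    have "\<exists>C. \<forall>j. \<bar>pochhammer (real m) j / fact j\<bar> * s ^ j \<le> C"
    proof (rule geometric_bound_if_ratio_tendsto_1[OF _ tendsto_linear_ratio s])
      show "pochhammer (real m) (Suc j) / fact (Suc j) =
              (real m + 1 * real j) / (1 + 1 * real j) * (pochhammer (real m) j / fact j)" for j
        by (simp add: pochhammer_Suc mult_ac)
    qed simp
    then show ?thesis using that by blast
  qed
  obtain C3 where C3: "\<And>k. \<bar>pochhammer (a + of_nat m) k / pochhammer a (k + 1)\<bar> * s ^ k \<le> C3"
  proof -
    have "\<exists>C. \<forall>k. \<bar>pochhammer (a + of_nat m) k / pochhammer a (k + 1)\<bar> * s ^ k \<le> C"
    proof (rule geometric_bound_if_ratio_tendsto_1[OF _ tendsto_linear_ratio s])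
      show "pochhammer (a + of_nat m) (Suc k) / pochhammer a (Suc k + 1) =
              (a + of_nat m + 1 * real k) / (a + 1 + 1 * real k) *
                (pochhammer (a + of_nat m) k / pochhammer a (k + 1))" for k
        by (simp add: pochhammer_Suc mult_ac add_ac)
    qed simp
    then show ?thesis using that by blast
  qed
  have "\<bar>(2 * of_nat n + a) * (pochhammer (of_nat m) j / fact j) *
           (pochhammer (a + of_nat m) (2 * n + j) / pochhammer a (2 * n + j + 1))\<bar> *
           (s ^ n * s ^ j * s ^ (2 * n + j)) \<le> C1 * C2 * C3" for n j
  proof -
    have "\<bar>(2 * of_nat n + a) * (pochhammer (of_nat m) j / fact j) *
           (pochhammer (a + of_nat m) (2 * n + j) / pochhammer a (2 * n + j + 1))\<bar> *
           (s ^ n * s ^ j * s ^ (2 * n + j)) =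
          (\<bar>2 * of_nat n + a\<bar> * s ^ n) * (\<bar>pochhammer (real m) j / fact j\<bar> * s ^ j) *
          (\<bar>pochhammer (a + of_nat m) (2 * n + j) / pochhammer a (2 * n + j + 1)\<bar> * s ^ (2 * n + j))"
      unfolding abs_mult by (simp only: mult_ac)
    also have "\<dots> \<le> C1 * C2 * C3"
      using s C1[of 0] C2[of 0]
      by (intro mult_mono C1 C2 C3 mult_nonneg_nonneg) (auto intro: order_trans[OF _ C1] order_trans[OF _ C2])
    finally show ?thesis .
  qed
  then show ?thesis by blast
qed

section \<open>The expansion without the elementary factors\<close>

lemma powr_inverse_not_nonpos:
  fixes z s :: complex
  assumes "z \<notin> \<real>\<^sub>\<le>\<^sub>0"
  shows "(1 / z) powr s = z powr (- s)"
  using assms Ln_inverse[OF assms] by (auto simp: powr_def inverse_eq_divide)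

text \<open>Pfaff's transformation turns the terminating hypergeometric polynomial in \<open>-\<rho> / (1 - \<rho>)\<close>, to which the
Legendre function of degree \<open>-m\<close> reduces, into a power series in \<open>\<rho>\<close>. The series converges in the whole
disc because \<open>-\<rho> / (1 - \<rho>)\<close> stays in the slit plane.\<close>
lemma pfaff_power_series_sums:
  fixes d :: real and m :: nat
  assumes d: "d > 0" and \<rho>: "norm \<rho> < 1"
  shows "(\<lambda>j. pochhammer (of_nat m) j * pochhammer (of_real (d - 1 + of_nat m)) j / (pochhammer (of_real d) j * fact j) * \<rho> ^ j) sums
           (gauss_2F1 (of_nat m) (of_real (1 - of_nat m)) (of_real d) (- \<rho> / (1 - \<rho>)) / (1 - \<rho>) ^ m)"
proof -
  define h where "h = gauss_2F1 (of_nat m) (of_real (1 - of_nat m)) (of_real d)"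
  have h: "h has_fps_expansion fps_hypergeo [of_nat m, of_real (1 - of_nat m)] [of_real d] 1"
    unfolding h_def by (intro gauss_2F1_has_fps_expansion d)
  define P where "P = (\<lambda>z. (1 + z) powr (- of_nat m) * h (z * (1 + z) powr (-1)))"
  have "of_real d - of_real (d - 1 + of_nat m) = (of_real (1 - of_nat m) :: complex)"
    by simp
  then have P: "P has_fps_expansion fps_hypergeo [of_nat m, of_real (d - 1 + of_nat m)] [of_real d] (-1)"
    unfolding P_def using h by (intro pfaff_expansion pochhammer_of_real_pos_nonzero d) (simp only:)
  define Q where "Q = (\<lambda>z. h (- z / (1 - z)) / (1 - z) ^ m)"
  have "(P \<circ> (\<lambda>z. (-1) * z)) has_fps_expansion
          fps_compose (fps_hypergeo [of_nat m, of_real (d - 1 + of_nat m)] [of_real d] (-1)) (fps_const (-1) * fps_X)"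
    by (intro has_fps_expansion_compose P fps_expansion_intros) auto
  also have "fps_compose (fps_hypergeo [of_nat m, of_real (d - 1 + of_nat m)] [of_real d] (-1)) (fps_const (-1) * fps_X) =
      fps_hypergeo [of_nat m, of_real (d - 1 + of_nat m)] [of_real d] (1 :: complex)"
    unfolding fps_compose_linear
    by (rule fps_ext) (simp flip: power_mult_distrib)
  also have "(P \<circ> (\<lambda>z. (-1) * z)) has_fps_expansion fps_hypergeo [of_nat m, of_real (d - 1 + of_nat m)] [of_real d] (1 :: complex) \<longleftrightarrow>
      Q has_fps_expansion fps_hypergeo [of_nat m, of_real (d - 1 + of_nat m)] [of_real d] (1 :: complex)"
  proof (rule has_fps_expansion_cong)
    have "\<forall>\<^sub>F z in nhds 0. z \<in> ball 0 (1 :: real)"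
      by (intro eventually_nhds_in_open) auto
    then show "\<forall>\<^sub>F z in nhds 0. (P \<circ> (\<lambda>z. (-1) * z)) z = Q z"
    proof eventually_elim
      case (elim z)
      then have "1 - z \<noteq> 0" by auto
      then show ?case
        by (simp add: P_def Q_def powr_minus powr_nat' divide_inverse mult_ac)
    qed
  qed simp
  finally have Q: "Q has_fps_expansion fps_hypergeo [of_nat m, of_real (d - 1 + of_nat m)] [of_real d] (1 :: complex)" .
  have slit: "- z / (1 - z) \<in> slit_plane" if z: "norm z < 1" for z
  proof (rule ccontr)
    assume "- z / (1 - z) \<notin> slit_plane"
    then obtain s where s: "s \<ge> 1" "- z / (1 - z) = of_real s"
      by (auto simp: slit_plane_def)
    have "1 - z \<noteq> 0" using z by auto
    with s have "- z = of_real s * (1 - z)" by (simp add: field_simps)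
    then have "1 = of_real (1 - s) * (1 - z)" by (simp add: algebra_simps)
    then have "1 = (1 - s) * (1 - Re z)"
      by (metis Re_complex_of_real Im_complex_of_real times_complex.sel(1) mult_zero_left diff_zero minus_complex.sel(1) one_complex.sel(1))
    moreover have "(1 - s) * (1 - Re z) \<le> 0"
      using s z complex_Re_le_cmod[of z] by (intro mult_nonpos_nonneg) auto
    ultimately show False by simp
  qed
  have "(h \<circ> (\<lambda>z. - z / (1 - z))) holomorphic_on ball 0 1"
    unfolding h_def using slit
    by (intro holomorphic_on_compose_gen[OF _ gauss_2F1_holomorphic[OF d]] holomorphic_intros) auto
  then have "Q holomorphic_on ball 0 1"
    unfolding Q_def o_def by (intro holomorphic_intros) auto
  then show ?thesis
    using has_fps_expansion_imp_sums_complex[OF Q, of 1 \<rho>] \<rho>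
    by (simp add: one_ereal_def Q_def h_def)
qed

text \<open>The coefficient \<open>a\<^bsub>n,m\<^esub>\<close> of the theorem without \<open>common_factor\<close>, for the expansion in terms of
\<open>scaled_jacobi\<close> instead of \<open>jacobi_P\<close>; here \<open>a = \<alpha> + \<beta> + 1\<close>.\<close>
definition reduced_coeff :: "real \<Rightarrow> nat \<Rightarrow> nat \<Rightarrow> complex \<Rightarrow> complex" where
  "reduced_coeff a m n \<rho> = of_real ((2 * of_nat n + a) * (pochhammer (a + of_nat m) (2 * n) / pochhammer a (2 * n + 1))) * \<rho> ^ n *
     (gauss_2F1 (of_nat m) (of_real (1 - of_nat m)) (of_real (a + 2 * of_nat n + 1)) (- \<rho> / (1 - \<rho>)) / (1 - \<rho>) ^ m)"

lemma reduced_coeff_sums: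
  assumes a: "a > -1" "a \<noteq> 0" and \<rho>: "norm \<rho> < 1"
  shows "(\<lambda>j. of_real ((2 * of_nat n + a) * (pochhammer (of_nat m) j / fact j) *
            (pochhammer (a + of_nat m) (2 * n + j) / pochhammer a (2 * n + j + 1))) * \<rho> ^ (n + j)) sums
           reduced_coeff a m n \<rho>"
proof -
  define d where "d = a + 2 * of_nat n + 1"
  have d: "d > 0" using a by (simp add: d_def)
  define k where "k = (2 * of_nat n + a) * (pochhammer (a + of_nat m) (2 * n) / pochhammer a (2 * n + 1))"
  have "(\<lambda>j. (of_real k * \<rho> ^ n) * (pochhammer (of_nat m) j * pochhammer (of_real (d - 1 + of_nat m)) j /
          (pochhammer (of_real d) j * fact j) * \<rho> ^ j)) sums reduced_coeff a m n \<rho>"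
    unfolding reduced_coeff_def k_def [symmetric] d_def [symmetric] by (intro sums_mult pfaff_power_series_sums d \<rho>)
  moreover have "(of_real k * \<rho> ^ n) * (pochhammer (of_nat m) j * pochhammer (of_real (d - 1 + of_nat m)) j /
          (pochhammer (of_real d) j * fact j) * \<rho> ^ j) =
        of_real ((2 * of_nat n + a) * (pochhammer (of_nat m) j / fact j) *
            (pochhammer (a + of_nat m) (2 * n + j) / pochhammer a (2 * n + j + 1))) * \<rho> ^ (n + j)" for j
  proof -
    have 1: "pochhammer (a + of_nat m) (2 * n + j) = pochhammer (a + of_nat m) (2 * n) * pochhammer (d - 1 + of_nat m) j"
      using pochhammer_product'[of "a + of_nat m" "2 * n" j] by (simp add: d_def add_ac)
    have 2: "pochhammer a (2 * n + j + 1) = pochhammer a (2 * n + 1) * pochhammer d j"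
      using pochhammer_product'[of a "2 * n + 1" j] by (simp add: d_def add_ac)
    have 3: "pochhammer (of_nat m :: complex) j = of_real (pochhammer (of_nat m) j)"
      by (simp flip: pochhammer_of_real)
    have "(of_real k * \<rho> ^ n) * (pochhammer (of_nat m) j * pochhammer (of_real (d - 1 + of_nat m)) j /
          (pochhammer (of_real d) j * fact j) * \<rho> ^ j) =
        of_real (k * (pochhammer (of_nat m) j * pochhammer (d - 1 + of_nat m) j / (pochhammer d j * fact j))) * \<rho> ^ (n + j)"
      unfolding pochhammer_of_real 3 by (simp add: power_add mult_ac)
    also have "k * (pochhammer (of_nat m) j * pochhammer (d - 1 + of_nat m) j / (pochhammer d j * fact j)) =
        (2 * of_nat n + a) * (pochhammer (of_nat m) j / fact j) *
            (pochhammer (a + of_nat m) (2 * n + j) / pochhammer a (2 * n + j + 1))"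
      unfolding 1 2 k_def by (simp add: mult_ac)
    finally show ?thesis .
  qed
  ultimately show ?thesis by (simp only:)
qed

text \<open>Summing the double series with terms \<open>B n j * \<rho>\<^bsup>n+j\<^esup> * S a n\<close> by rows gives the coefficients
\<open>reduced_coeff\<close>; summing it along the diagonals \<open>n + j = N\<close> gives, by the connection formula, the
generating function of \<open>S (a + m) N\<close>.\<close>
theorem reduced_gen_fun_jacobi_expansion:
  assumes a: "a > -1" "a \<noteq> 0" and \<beta>: "\<beta> > -1" and x: "x \<in> {-1..1}" and \<rho>: "norm \<rho> < 1"
  shows "(\<lambda>n. reduced_coeff a m n \<rho> * scaled_jacobi (of_real a) (of_real (\<beta> + 1)) ((1 + of_real x) / 2) n) sums
           reduced_gen_fun (a + of_nat m - \<beta> - 1) \<beta> x \<rho>"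
proof -
  define J where "J = scaled_jacobi (of_real a) (of_real (\<beta> + 1)) ((1 + of_real x) / 2)"
  define B where "B n j = (2 * of_nat n + a) * (pochhammer (of_nat m) j / fact j) *
            (pochhammer (a + of_nat m) (2 * n + j) / pochhammer a (2 * n + j + 1))" for n j
  define u where "u n j = of_real (B n j) * \<rho> ^ (n + j) * J n" for n j
  have anz: "a + of_nat i \<noteq> 0" for i
    using a by (cases i) auto
  define r where "r = norm \<rho>"
  \<comment> \<open>The bounds below cost a factor \<open>s\<^bsup>-4\<^esup>\<close> for each \<open>n\<close> and \<open>s\<^bsup>-2\<^esup>\<close> for each \<open>j\<close>; with \<open>s\<^sup>4\<close> halfway
      between \<open>|\<rho>|\<close> and 1 both geometric ratios remain below 1.\<close>
  define s where "s = sqrt (sqrt ((1 + r) / 2))"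
  have r: "0 \<le> r" "r < 1" using \<rho> by (auto simp: r_def)
  have s: "0 < s" "s < 1" using r by (auto simp: s_def)
  have s4: "s ^ 4 = (1 + r) / 2"
  proof -
    have "s ^ 4 = (s\<^sup>2)\<^sup>2" by (simp flip: power_mult)
    then show ?thesis using r by (simp add: s_def)
  qed
  have s2: "s ^ 4 \<le> s ^ 2"
    using s by (intro power_decreasing) auto
  obtain C1 where C1: "\<And>n j. \<bar>B n j\<bar> * (s ^ n * s ^ j * s ^ (2 * n + j)) \<le> C1"
    using connection_coefficients_bound[OF anz s, of m] unfolding B_def by blast
  obtain C2 where C2: "\<And>n. norm (J n) * s ^ n \<le> C2"
    using scaled_jacobi_bound[OF x \<beta> s, of a] unfolding J_def by blast
  show ?thesis
    unfolding J_def [symmetric]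
  proof (rule sums_rearrange_diagonals)
    show "norm (u n j) \<le> C1 * C2 * ((r / s ^ 4) ^ n * (r / s ^ 2) ^ j)" for n j
    proof -
      have "norm (u n j) * ((s ^ 4) ^ n * (s ^ 2) ^ j) =
          (\<bar>B n j\<bar> * (s ^ n * s ^ j * s ^ (2 * n + j))) * (norm (J n) * s ^ n) * (r ^ n * r ^ j)"
      proof -
        have "(s ^ 4) ^ n * (s ^ 2) ^ j = s ^ n * s ^ j * s ^ (2 * n + j) * s ^ n"
          unfolding power_mult [symmetric] power_add [symmetric]
          by (rule arg_cong[where f = "power s"]) simp
        moreover have "norm (u n j) = \<bar>B n j\<bar> * norm (J n) * (r ^ n * r ^ j)"
          by (simp add: u_def r_def norm_mult norm_power power_add)
        ultimately show ?thesis
          by (simp only: mult_ac)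
      qed
      also have "\<dots> \<le> C1 * C2 * (r ^ n * r ^ j)"
        using s r C1[of 0 0] C2[of 0]
        by (intro mult_right_mono mult_mono C1 C2) (auto intro: order_trans[OF _ C1])
      finally show ?thesis
        using s by (simp add: power_divide field_simps)
    qed
    show "0 \<le> r / s ^ 4" "0 \<le> r / s\<^sup>2" using r s by auto
    show "r / s ^ 4 < 1" using r s s4 by (simp add: field_simps)
    have "r < (1 + r) / 2" using r by simp
    also have "\<dots> \<le> s\<^sup>2" using s2 unfolding s4 .
    finally have "r < s\<^sup>2" .
    then show "r / s\<^sup>2 < 1" using s by simp
    show "u n sums (reduced_coeff a m n \<rho> * J n)" for n
      unfolding u_def B_def by (intro sums_mult2 reduced_coeff_sums a \<rho>)
    have "(\<Sum>n\<le>N. u n (N - n)) =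
        scaled_jacobi (of_real (a + of_nat m)) (of_real (\<beta> + 1)) ((1 + of_real x) / 2) N * \<rho> ^ N" for N
    proof -
      have anz': "complex_of_real a + of_nat i \<noteq> 0" for i
        using anz[of i] by (metis of_real_add of_real_eq_0_iff of_real_of_nat_eq)
      have poch: "pochhammer (of_nat m :: complex) j = of_real (pochhammer (of_nat m) j)"
        "pochhammer (of_real a + of_nat m :: complex) j = of_real (pochhammer (a + of_nat m) j)"
        "pochhammer (of_real a :: complex) j = of_real (pochhammer a j)" for j
        by (simp_all flip: pochhammer_of_real)
      show ?thesis
        unfolding of_real_add of_real_of_nat_eq scaled_jacobi_connection[OF anz'] sum_distrib_right
      proof (intro sum.cong refl)
        fix n assume "n \<in> {..N}"
        then have n: "n + (N - n) = N" "2 * n + (N - n) = n + N" by auto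
        show "u n (N - n) = (2 * of_nat n + of_real a) *
            scaled_jacobi (of_real a) (of_real \<beta> + of_real 1) ((1 + of_real x) / 2) n *
            (pochhammer (of_nat m) (N - n) / fact (N - n)) *
            (pochhammer (of_real a + of_nat m) (n + N) / pochhammer (of_real a) (n + N + 1)) * \<rho> ^ N"
          unfolding u_def B_def n poch by (simp add: J_def mult_ac)
      qed
    qed
    moreover have "a + of_nat m - \<beta> - 1 + \<beta> + 1 = a + of_nat m" by simp
    ultimately show "(\<lambda>N. \<Sum>n\<le>N. u n (N - n)) sums reduced_gen_fun (a + of_nat m - \<beta> - 1) \<beta> x \<rho>"
      using reduced_gen_fun_sums[OF x \<beta> \<rho>, of "a + of_nat m - \<beta> - 1"] by (simp only:)
  qed
qed

section \<open>The elementary factors and the choice of branches\<close>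

text \<open>Here \<open>e\<close> is \<open>1 + x\<close>. Multiplying the equation by the conjugate of \<open>q - e\<close> and taking imaginary parts
shows that \<open>2 |q - e|\<^sup>2 Im \<rho>\<close> is a non-negative multiple of \<open>Im q\<close>, because \<open>e (2 - e) \<ge> 0\<close>. The
inequalities in the conclusion are not strict since \<open>q = 2\<close> for all \<open>\<rho>\<close> when \<open>x = 1\<close>.\<close>
lemma Im_q_sign:
  fixes \<rho> q :: complex and e :: real
  assumes e: "0 \<le> e" "e \<le> 2" and eq: "2 * \<rho> * (q - of_real e) = q * (q - 2)"
  shows "Im \<rho> > 0 \<Longrightarrow> Im q \<ge> 0" and "Im \<rho> < 0 \<Longrightarrow> Im q \<le> 0"
proof -
  define N where "N = (Re q - e)\<^sup>2 + (Im q)\<^sup>2 + e * (2 - e)"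
  have N: "N \<ge> 0" unfolding N_def using e by simp
  have "2 * \<rho> * (q - of_real e) * cnj (q - of_real e) = q * (q - 2) * cnj (q - of_real e)"
    unfolding eq ..
  moreover have "2 * \<rho> * (q - of_real e) * cnj (q - of_real e) = of_real (2 * (norm (q - of_real e))\<^sup>2) * \<rho>"
    unfolding mult.assoc complex_norm_square [symmetric] by simp
  ultimately have "Im (of_real (2 * (norm (q - of_real e))\<^sup>2) * \<rho>) = Im (q * (q - 2) * cnj (q - of_real e))"
    by (simp only:)
  also have "Im (q * (q - 2) * cnj (q - of_real e)) = Im q * N"
    by (simp add: N_def power2_eq_square algebra_simps)
  finally have *: "2 * (norm (q - of_real e))\<^sup>2 * Im \<rho> = Im q * N"
    by simp
  have q: "Im q = 0" if "q = of_real e"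
    using that by simp
  show "Im q \<ge> 0" if "Im \<rho> > 0"
  proof (cases "q = of_real e")
    case False
    then have "Im q * N > 0"
      unfolding * [symmetric] using that by simp
    then show ?thesis using N by (simp add: zero_less_mult_iff)
  qed (use q in auto)
  show "Im q \<le> 0" if "Im \<rho> < 0"
  proof (cases "q = of_real e")
    case False
    then have "Im q * N < 0"
      unfolding * [symmetric] using that by (simp add: mult_pos_neg)
    then show ?thesis using N by (simp add: mult_less_0_iff)
  qed (use q in auto)
qed

text \<open>As \<open>(\<zeta> + 1) / (\<zeta> - 1) = q\<^sup>2 / (2 \<rho> (1 + x))\<close>, the claim is that the principal logarithms add up. Both
\<open>2 Arg q\<close> and \<open>Arg \<rho>\<close> lie between \<open>-\<pi>\<close> and \<open>\<pi>\<close>, and they do not have opposite signs, so their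
difference stays in this interval.\<close>
lemma zeta_quotient_powr:
  fixes s :: complex
  assumes x: "x \<in> {-1<..1}" and \<rho>: "norm \<rho> < 1" "\<rho> \<notin> \<real>\<^sub>\<le>\<^sub>0"
  defines "q \<equiv> 1 + \<rho> + R_fun \<rho> x"
  shows "((zeta_plus \<rho> x + 1) / (zeta_plus \<rho> x - 1)) powr s =
           q powr (2 * s) * \<rho> powr (- s) * of_real (2 * (1 + x)) powr (- s)"
proof -
  define R where "R = R_fun \<rho> x"
  have x': "x \<in> {-1..1}" using x by auto
  have nz: "R \<noteq> 0" "\<rho> \<noteq> 0" "1 + x > 0"
    using R_fun_nonzero[OF \<rho>(1) x'] \<rho> x by (auto simp: R_def)
  have q: "Re q > 0" using Re_q_pos[OF \<rho>(1) x'] by (simp add: q_def)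
  then have qnz: "q \<noteq> 0" by auto
  have R2: "R\<^sup>2 = 1 + \<rho>\<^sup>2 - 2 * \<rho> * of_real x"
    by (simp add: R_def R_fun_sq)
  have key: "(1 + \<rho> - R) * q = 2 * \<rho> * of_real (1 + x)"
  proof -
    have "(1 + \<rho> - R) * q = (1 + \<rho>)\<^sup>2 - R\<^sup>2"
      by (simp add: q_def R_def power2_eq_square algebra_simps)
    also have "\<dots> = 2 * \<rho> * of_real (1 + x)"
      unfolding R2 by (simp add: power2_eq_square algebra_simps)
    finally show ?thesis .
  qed
  have xnz: "complex_of_real (1 + x) \<noteq> 0" using nz by (simp only: of_real_eq_0_iff)
  then have nz2: "1 + \<rho> - R \<noteq> 0"
    using key nz by auto
  have "(zeta_plus \<rho> x + 1) / (zeta_plus \<rho> x - 1) = q / (1 + \<rho> - R)"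
    using nz nz2 by (simp add: zeta_plus_def R_def [symmetric] q_def divide_simps)
  also have "\<dots> = q\<^sup>2 / (\<rho> * of_real (2 * (1 + x)))"
  proof -
    have "q / (1 + \<rho> - R) = q * q / ((1 + \<rho> - R) * q)"
      using qnz by simp
    then show ?thesis
      unfolding key by (simp add: power2_eq_square mult_ac)
  qed
  finally have w: "(zeta_plus \<rho> x + 1) / (zeta_plus \<rho> x - 1) = q\<^sup>2 / (\<rho> * of_real (2 * (1 + x)))" .
  have Ln: "Ln (q\<^sup>2 / (\<rho> * of_real (2 * (1 + x)))) = 2 * Ln q - Ln \<rho> - of_real (ln (2 * (1 + x)))"
  proof (rule Ln_unique)
    show "exp (2 * Ln q - Ln \<rho> - of_real (ln (2 * (1 + x)))) = q\<^sup>2 / (\<rho> * of_real (2 * (1 + x)))"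
      using nz qnz by (simp add: exp_diff exp_double exp_of_real del: of_real_mult of_real_add)
    have eq: "2 * \<rho> * (q - of_real (1 + x)) = q * (q - 2)"
    proof -
      have "q * (q - 2) = 2 * \<rho> * q - (1 + \<rho> - R) * q"
        by (simp add: q_def R_def algebra_simps)
      then show ?thesis
        unfolding key by (simp add: algebra_simps)
    qed
    have sgn: "Im \<rho> > 0 \<Longrightarrow> Im q \<ge> 0" "Im \<rho> < 0 \<Longrightarrow> Im q \<le> 0"
      using Im_q_sign[OF _ _ eq] x by auto
    have argq: "\<bar>Im (Ln q)\<bar> < pi / 2"
      using Re_Ln_pos_lt[OF qnz] q by blast
    have "-pi < 2 * Im (Ln q) - Im (Ln \<rho>) \<and> 2 * Im (Ln q) - Im (Ln \<rho>) < pi"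
    proof (cases "Im \<rho> = 0")
      case True
      then have "Re \<rho> > 0" using \<rho>(2) by (auto simp: complex_nonpos_Reals_iff)
      then have "Im (Ln \<rho>) = 0"
        using True nz(2) Im_Ln_eq_0 by blast
      then show ?thesis using argq by auto
    next
      case False
      show ?thesis
      proof (cases "Im \<rho> > 0")
        case True
        then have "0 < Im (Ln \<rho>)" "Im (Ln \<rho>) < pi"
          using Im_Ln_pos_lt_imp by blast+
        moreover have "0 \<le> Im (Ln q)"
          using sgn(1)[OF True] Im_Ln_pos_le[OF qnz] q by auto
        ultimately show ?thesis using argq by auto
      next
        case False
        then have neg: "Im \<rho> < 0" using \<open>Im \<rho> \<noteq> 0\<close> by auto
        then have "Im (Ln \<rho>) < 0" "- pi < Im (Ln \<rho>)"
          using Im_Ln_pos_le[OF nz(2)] mpi_less_Im_Ln[OF nz(2)] Im_Ln_le_pi[OF nz(2)] by auto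
        moreover have "Im (Ln q) \<le> 0"
          using sgn(2)[OF neg] Im_Ln_pos_lt[OF qnz] Im_Ln_le_pi[OF qnz] argq by auto
        ultimately show ?thesis using argq by auto
      qed
    qed
    then show "- pi < Im (2 * Ln q - Ln \<rho> - of_real (ln (2 * (1 + x))))"
      "Im (2 * Ln q - Ln \<rho> - of_real (ln (2 * (1 + x)))) \<le> pi"
      by auto
  qed
  have "q\<^sup>2 / (\<rho> * of_real (2 * (1 + x))) \<noteq> 0"
    using nz qnz by (simp del: of_real_mult of_real_add)
  moreover have "Ln (of_real (2 * (1 + x))) = of_real (ln (2 * (1 + x)))"
    using nz by (intro Ln_of_real) auto
  moreover have "complex_of_real (2 * (1 + x)) \<noteq> 0"
    using nz unfolding of_real_eq_0_iff by simp
  ultimately have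
    "(q\<^sup>2 / (\<rho> * of_real (2 * (1 + x)))) powr s = exp (s * (2 * Ln q - Ln \<rho> - of_real (ln (2 * (1 + x)))))"
    "complex_of_real (2 * (1 + x)) powr (- s) = exp (- s * of_real (ln (2 * (1 + x))))"
    by (simp_all only: powr_def Ln if_False)
  moreover have "q powr (2 * s) = exp (2 * s * Ln q)" "\<rho> powr (- s) = exp (- s * Ln \<rho>)"
    using nz qnz by (simp_all add: powr_def)
  ultimately show ?thesis
    unfolding w by (simp only: exp_add [symmetric]) (simp add: algebra_simps)
qed

text \<open>The factor shared by both sides of the theorem; it depends on neither \<open>x\<close> nor \<open>n\<close> and carries the branch
cut along \<open>(-1, 0]\<close>.\<close>
definition common_factor :: "real \<Rightarrow> complex \<Rightarrow> complex" where
  "common_factor \<beta> \<rho> = of_real (2 powr (- \<beta> / 2) / Gamma (\<beta> + 1)) * \<rho> powr of_real (\<beta> / 2)"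

lemma gen_fun_conv_reduced:
  assumes x: "x \<in> {-1<..1}" and \<rho>: "norm \<rho> < 1" "\<rho> \<notin> \<real>\<^sub>\<le>\<^sub>0" and \<beta>: "\<beta> > -1"
  shows "gen_fun \<alpha> \<beta> m \<rho> x = common_factor \<beta> \<rho> * reduced_gen_fun (\<alpha> + of_nat m) \<beta> x \<rho>"
proof -
  define q R where "q = 1 + \<rho> + R_fun \<rho> x" and "R = R_fun \<rho> x"
  define F where "F = gauss_2F1 (of_real (- (\<alpha> + of_nat m))) (of_real (\<alpha> + of_nat m + 1)) (of_real (\<beta> + 1)) ((1 - zeta_plus \<rho> x) / 2)"
  have x': "x \<in> {-1..1}" using x by auto
  have q: "Re q > 0" using Re_q_pos[OF \<rho>(1) x'] by (simp add: q_def)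
  have "((zeta_plus \<rho> x + 1) / (zeta_plus \<rho> x - 1)) powr (of_real (- \<beta>) / 2) =
      q powr (- of_real \<beta>) * \<rho> powr of_real (\<beta> / 2) * of_real (2 * (1 + x)) powr of_real (\<beta> / 2)"
    using zeta_quotient_powr[OF x \<rho>, of "of_real (- \<beta>) / 2"] by (simp add: q_def)
  also have "of_real (2 * (1 + x)) powr of_real (\<beta> / 2) = complex_of_real ((2 * (1 + x)) powr (\<beta> / 2))"
    using x by (intro powr_of_real) auto
  also have "q powr (- of_real \<beta>) = of_real (2 powr (- \<beta>)) * (2 / q) powr of_real \<beta>"
  proof -
    have "(2 / q) powr of_real \<beta> = 2 powr of_real \<beta> * q powr (- of_real \<beta>)"
      using powr_mult_Re_pos[of 2 "1 / q" "of_real \<beta>"] powr_inverse_Re_pos[OF q, of "of_real \<beta>"]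
        Re_divide_pos[OF q, of 1] by simp
    moreover have "2 powr of_real \<beta> = complex_of_real (2 powr \<beta>)"
      using powr_of_real[of 2 \<beta>] by simp
    ultimately show ?thesis
      by (simp add: powr_minus field_simps)
  qed
  finally have *: "((zeta_plus \<rho> x + 1) / (zeta_plus \<rho> x - 1)) powr (of_real (- \<beta>) / 2) =
      of_real (2 powr (- \<beta>)) * (2 / q) powr of_real \<beta> *
        \<rho> powr of_real (\<beta> / 2) * of_real ((2 * (1 + x)) powr (\<beta> / 2))" .
  have L: "legendre_P (of_real (\<alpha> + of_nat m)) (of_real (- \<beta>)) (zeta_plus \<rho> x) =
      1 / Gamma (of_real (\<beta> + 1)) * (of_real (2 powr (- \<beta>)) * (2 / q) powr of_real \<beta> *
        \<rho> powr of_real (\<beta> / 2) * of_real ((2 * (1 + x)) powr (\<beta> / 2))) * F"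
  proof -
    have "- complex_of_real (\<alpha> + of_nat m) = of_real (- (\<alpha> + of_nat m))"
      "complex_of_real (\<alpha> + of_nat m) + 1 = of_real (\<alpha> + of_nat m + 1)"
      "1 - complex_of_real (- \<beta>) = of_real (\<beta> + 1)"
      by simp_all
    then show ?thesis
      unfolding legendre_P_def F_def using * by (simp only:)
  qed
  have "(1 + x) powr (- \<beta> / 2) * (2 powr (- \<beta>) * (2 * (1 + x)) powr (\<beta> / 2)) =
      (2 powr (- \<beta>) * 2 powr (\<beta> / 2)) * ((1 + x) powr (- \<beta> / 2) * (1 + x) powr (\<beta> / 2))"
  proof -
    have "(2 * (1 + x)) powr (\<beta> / 2) = 2 powr (\<beta> / 2) * (1 + x) powr (\<beta> / 2)"
      using x by (simp only: powr_mult)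
    then show ?thesis by (simp only: mult_ac)
  qed
  also have "\<dots> = 2 powr (- \<beta> / 2)"
    using x by (simp flip: powr_add)
  finally have P: "(1 + x) powr (- \<beta> / 2) * (2 powr (- \<beta>) * (2 * (1 + x)) powr (\<beta> / 2)) = 2 powr (- \<beta> / 2)" .
  have "gen_fun \<alpha> \<beta> m \<rho> x = of_real ((1 + x) powr (- \<beta> / 2) * (2 powr (- \<beta>) * (2 * (1 + x)) powr (\<beta> / 2))) / Gamma (of_real (\<beta> + 1)) *
     \<rho> powr of_real (\<beta> / 2) * ((2 / q) powr of_real \<beta> * (1 / R powr of_real (\<alpha> + of_nat m + 1)) * F)"
    unfolding gen_fun_def L R_def by (simp add: mult_ac)
  also have "1 / R powr of_real (\<alpha> + of_nat m + 1) = R powr of_real (- (\<alpha> + of_nat m + 1))"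
    unfolding of_real_minus powr_minus by (simp add: divide_inverse)
  also have "Gamma (complex_of_real (\<beta> + 1)) = of_real (Gamma (\<beta> + 1))"
    by (rule Gamma_complex_of_real)
  finally show ?thesis
    unfolding P by (simp add: common_factor_def reduced_gen_fun_def q_def R_def F_def mult_ac)
qed

text \<open>At \<open>z = (1 + \<rho>) / (1 - \<rho>)\<close> one has \<open>(z + 1) / (z - 1) = 1 / \<rho>\<close> and \<open>(1 - z) / 2 = -\<rho> / (1 - \<rho>)\<close>, so
the powers of \<open>\<rho>\<close> combine to \<open>\<rho>\<^bsup>\<beta>/2 + n\<^esup>\<close>.\<close>
lemma coeff_a_conv_reduced:
  assumes \<alpha>: "\<alpha> > -1" and \<beta>: "\<beta> > -1" and nz: "\<alpha> + \<beta> + 1 \<noteq> 0"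
    and \<rho>: "norm \<rho> < 1" "\<rho> \<notin> \<real>\<^sub>\<le>\<^sub>0"
  shows "coeff_a \<alpha> \<beta> n m \<rho> =
           common_factor \<beta> \<rho> * (reduced_coeff (\<alpha> + \<beta> + 1) m n \<rho> *
             of_real (pochhammer (\<alpha> + \<beta> + 1) n / pochhammer (\<beta> + 1) n))"
proof -
  define a where "a = \<alpha> + \<beta> + 1"
  define F where "F = gauss_2F1 (of_nat m) (of_real (1 - of_nat m)) (of_real (a + 2 * of_nat n + 1)) (- \<rho> / (1 - \<rho>))"
  have a: "a > -1" "a \<noteq> 0" using \<alpha> \<beta> nz by (auto simp: a_def)
  have "a \<notin> \<int>\<^sub>\<le>\<^sub>0"
  proof
    assume "a \<in> \<int>\<^sub>\<le>\<^sub>0"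
    then obtain k where "a = - of_nat k" by (elim nonpos_Ints_cases')
    with a show False by (cases k) auto
  qed
  then have Ga: "Gamma a \<noteq> 0" "\<And>k. Gamma (a + of_nat k) = pochhammer a k * Gamma a"
    using pochhammer_Gamma[of a] by (auto simp: Gamma_eq_zero_iff)
  have "\<beta> + 1 \<notin> \<int>\<^sub>\<le>\<^sub>0"
    using \<beta> nonpos_Ints_nonpos[of "\<beta> + 1"] by auto
  then have Gb: "Gamma (\<beta> + 1) \<noteq> 0" "\<And>k. Gamma (\<beta> + 1 + of_nat k) = pochhammer (\<beta> + 1) k * Gamma (\<beta> + 1)"
    using pochhammer_Gamma[of "\<beta> + 1"] by (auto simp: Gamma_eq_zero_iff)
  have \<rho>nz: "\<rho> \<noteq> 0" "1 - \<rho> \<noteq> 0" using \<rho> by auto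
  have z: "((1 + \<rho>) / (1 - \<rho>) + 1) / ((1 + \<rho>) / (1 - \<rho>) - 1) = 1 / \<rho>"
    "(1 - (1 + \<rho>) / (1 - \<rho>)) / 2 = - \<rho> / (1 - \<rho>)"
    using \<rho>nz by (simp_all add: field_simps)
  have "legendre_P (- of_nat m) (of_real (- \<alpha> - \<beta> - 2 * of_nat n - 1)) ((1 + \<rho>) / (1 - \<rho>)) =
      1 / Gamma (of_real (a + 2 * of_nat n + 1)) * (1 / \<rho>) powr of_real (- (a + 2 * of_nat n) / 2) * F"
  proof -
    have "1 - complex_of_real (- \<alpha> - \<beta> - 2 * of_nat n - 1) = of_real (a + 2 * of_nat n + 1)"
      "complex_of_real (- \<alpha> - \<beta> - 2 * of_nat n - 1) / 2 = of_real (- (a + 2 * of_nat n) / 2)"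
      "- of_nat m + 1 = complex_of_real (1 - of_nat m)" "- (- of_nat m) = (of_nat m :: complex)"
      by (simp_all add: a_def field_simps)
    then show ?thesis
      unfolding legendre_P_def z F_def by (simp only:)
  qed
  also have "(1 / \<rho>) powr of_real (- (a + 2 * of_nat n) / 2) = \<rho> powr of_real ((\<alpha> + 1) / 2) * \<rho> powr of_real (\<beta> / 2) * \<rho> ^ n"
  proof -
    have "(1 / \<rho>) powr of_real (- (a + 2 * of_nat n) / 2) = \<rho> powr (of_real ((\<alpha> + 1) / 2) + of_real (\<beta> / 2) + of_nat n)"
    proof -
      have "- complex_of_real (- (a + 2 * of_nat n) / 2) = of_real ((\<alpha> + 1) / 2 + \<beta> / 2 + of_nat n)"
        unfolding of_real_minus [symmetric] of_real_eq_iff by (simp add: a_def field_simps)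
      then show ?thesis
        unfolding powr_inverse_not_nonpos[OF \<rho>(2)] by simp
    qed
    then show ?thesis
      using \<rho>nz by (simp add: powr_add powr_nat')
  qed
  also have "Gamma (complex_of_real (a + 2 * of_nat n + 1)) = of_real (Gamma (a + 2 * of_nat n + 1))"
    by (rule Gamma_complex_of_real)
  also have "Gamma (a + 2 * of_nat n + 1) = pochhammer a (2 * n + 1) * Gamma a"
    using Ga(2)[of "2 * n + 1"] by (simp add: add_ac)
  finally have L: "legendre_P (- of_nat m) (of_real (- \<alpha> - \<beta> - 2 * of_nat n - 1)) ((1 + \<rho>) / (1 - \<rho>)) =
      1 / of_real (pochhammer a (2 * n + 1) * Gamma a) *
        (\<rho> powr of_real ((\<alpha> + 1) / 2) * \<rho> powr of_real (\<beta> / 2) * \<rho> ^ n) * F" .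
  have G1: "Gamma (\<alpha> + \<beta> + of_nat n + 1) = pochhammer a n * Gamma a"
    using Ga(2)[of n] by (simp add: a_def add_ac)
  have G2: "Gamma (\<beta> + of_nat n + 1) = pochhammer (\<beta> + 1) n * Gamma (\<beta> + 1)"
    using Gb(2)[of n] by (simp add: add_ac)
  have G3: "\<alpha> + \<beta> + of_nat m + 1 = a + of_nat m" "2 * of_nat n + \<alpha> + \<beta> + 1 = 2 * of_nat n + a"
    by (simp_all add: a_def)
  have powr_nz: "\<rho> powr of_real ((\<alpha> + 1) / 2) \<noteq> 0" using \<rho>nz by simp
  have two: "2 powr (- \<beta> / 2) = 1 / 2 powr (\<beta> / 2)"
    using powr_minus_divide[of 2 "\<beta> / 2"] by simp
  show ?thesis
    unfolding coeff_a_def L G1 G2 G3 common_factor_def reduced_coeff_def a_def [symmetric] F_def [symmetric] two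
    using powr_nz Ga(1) by (simp add: mult_ac)
qed

text \<open>Supplies the limit at \<open>x = -1\<close> in the theorem.\<close>
lemma reduced_gen_fun_continuous_in_x:
  assumes \<beta>: "\<beta> > -1" and \<rho>: "norm \<rho> < 1"
  shows "continuous_on {-1..1} (\<lambda>x. reduced_gen_fun \<nu> \<beta> x \<rho>)"
proof -
  have R: "continuous_on {-1..1} (R_fun \<rho>)"
    unfolding R_fun_def using R_fun_radicand[OF \<rho>]
    by (intro continuous_on_compose2[OF holomorphic_on_imp_continuous_on[OF holomorphic_on_csqrt]] continuous_intros) auto
  have z: "continuous_on {-1..1} (\<lambda>x. (1 - zeta_plus \<rho> x) / 2)"
    unfolding zeta_plus_def using R_fun_nonzero[OF \<rho>] by (intro continuous_intros R) auto
  have F: "continuous_on {-1..1} (\<lambda>x. gauss_2F1 (of_real (-\<nu>)) (of_real (\<nu> + 1)) (of_real (\<beta> + 1)) ((1 - zeta_plus \<rho> x) / 2))"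
    using zeta_plus_slit_plane[OF \<rho>] \<beta>
    by (intro continuous_on_compose2[OF holomorphic_on_imp_continuous_on[OF gauss_2F1_holomorphic] z]) auto
  have q: "1 + \<rho> + R_fun \<rho> x \<noteq> 0" "2 / (1 + \<rho> + R_fun \<rho> x) \<notin> \<real>\<^sub>\<le>\<^sub>0" "R_fun \<rho> x \<notin> \<real>\<^sub>\<le>\<^sub>0" if "x \<in> {-1..1}" for x
    using Re_q_pos[OF \<rho> that] Re_divide_pos[OF Re_q_pos[OF \<rho> that], of 2] Re_R_fun_pos[OF \<rho> that]
    by (auto simp: complex_nonpos_Reals_iff)
  have base: "continuous_on {-1..1} (\<lambda>x. 2 / (1 + \<rho> + R_fun \<rho> x))"
    using q by (intro continuous_intros R) auto
  have powr: "continuous_on A (\<lambda>x. f x powr s)"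
    if "continuous_on A f" "\<And>x. x \<in> A \<Longrightarrow> f x \<notin> \<real>\<^sub>\<le>\<^sub>0" for A :: "real set" and f and s :: complex
  proof (intro continuous_on_powr_complex continuous_on_const that(1))
    fix x assume "x \<in> A" "f x = 0"
    then show "Re s > 0" using that(2)[of x] by simp
  qed (use that(2) in \<open>auto simp: complex_nonpos_Reals_iff\<close>)
  show ?thesis
    unfolding reduced_gen_fun_def using q by (intro continuous_on_mult powr base R F) auto
qed

theorem theorem1:
  fixes m :: nat and \<alpha> \<beta> x :: real and \<rho> :: complex
  assumes "\<alpha> > -1" and "\<beta> > -1"
    and "\<alpha> \<in> {-1<..<0} \<and> \<beta> \<in> {-1<..<0} \<longrightarrow> \<alpha> + \<beta> + 1 \<noteq> 0"
    and "x \<in> {-1..1}"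
    and "\<rho> \<in> ball 0 1 - complex_of_real ` {-1<..0}"
  shows
    "(x \<noteq> -1 \<longrightarrow>
        (\<lambda>n. coeff_a \<alpha> \<beta> n m \<rho> * jacobi_P n (of_real \<alpha>) (of_real \<beta>) (of_real x)) sums
          gen_fun \<alpha> \<beta> m \<rho> x) \<and>
     (x = -1 \<longrightarrow>
        (\<exists>L. (gen_fun \<alpha> \<beta> m \<rho> \<longlongrightarrow> L) (at_right (-1)) \<and>
          (\<lambda>n. coeff_a \<alpha> \<beta> n m \<rho> * jacobi_P n (of_real \<alpha>) (of_real \<beta>) (of_real x)) sums L))"
proof -
  define a where "a = \<alpha> + \<beta> + 1"
  have a: "a > -1" "a \<noteq> 0"
    using assms(1-3) by (auto simp: a_def)
  have \<rho>: "norm \<rho> < 1" "\<rho> \<notin> \<real>\<^sub>\<le>\<^sub>0"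
  proof -
    show "norm \<rho> < 1" using assms(5) by simp
    show "\<rho> \<notin> \<real>\<^sub>\<le>\<^sub>0"
    proof
      assume "\<rho> \<in> \<real>\<^sub>\<le>\<^sub>0"
      then obtain r where "r \<le> 0" "\<rho> = of_real r" by (elim nonpos_Reals_cases)
      with assms(5) show False by auto
    qed
  qed
  have sums: "(\<lambda>n. coeff_a \<alpha> \<beta> n m \<rho> * jacobi_P n (of_real \<alpha>) (of_real \<beta>) (of_real x)) sums
      (common_factor \<beta> \<rho> * reduced_gen_fun (\<alpha> + of_nat m) \<beta> x \<rho>)"
  proof -
    have "coeff_a \<alpha> \<beta> n m \<rho> * jacobi_P n (of_real \<alpha>) (of_real \<beta>) (of_real x) =
        common_factor \<beta> \<rho> * (reduced_coeff a m n \<rho> * scaled_jacobi (of_real a) (of_real (\<beta> + 1)) ((1 + of_real x) / 2) n)" for n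
    proof -
      have "pochhammer (of_real \<alpha> + 1 :: complex) n \<noteq> 0" "pochhammer (of_real \<beta> + 1 :: complex) n \<noteq> 0"
        using pochhammer_of_real_pos_nonzero[of "\<alpha> + 1" n] pochhammer_of_real_pos_nonzero[of "\<beta> + 1" n] assms(1,2)
        by simp_all
      from jacobi_P_conv_scaled_jacobi[OF this, of "of_real x"]
      have J: "scaled_jacobi (of_real a) (of_real (\<beta> + 1)) ((1 + of_real x) / 2) n =
          of_real (pochhammer a n / pochhammer (\<beta> + 1) n) * jacobi_P n (of_real \<alpha>) (of_real \<beta>) (of_real x)"
        by (simp add: a_def flip: pochhammer_of_real)
      show ?thesis
        unfolding J using coeff_a_conv_reduced[OF assms(1,2) _ \<rho>, of n m] a
        by (simp add: a_def mult_ac)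
    qed
    moreover have "a + of_nat m - \<beta> - 1 = \<alpha> + of_nat m"
      by (simp add: a_def)
    ultimately show ?thesis
      using sums_mult[OF reduced_gen_fun_jacobi_expansion[OF a assms(2,4) \<rho>(1)], of "common_factor \<beta> \<rho>" m] by (simp only:)
  qed
  have "((\<lambda>x. reduced_gen_fun (\<alpha> + of_nat m) \<beta> x \<rho>) \<longlongrightarrow> reduced_gen_fun (\<alpha> + of_nat m) \<beta> (-1) \<rho>) (at_right (-1))"
  proof -
    have "((\<lambda>x. reduced_gen_fun (\<alpha> + of_nat m) \<beta> x \<rho>) \<longlongrightarrow> reduced_gen_fun (\<alpha> + of_nat m) \<beta> (-1) \<rho>) (at (-1) within {-1..1})"
      using reduced_gen_fun_continuous_in_x[OF assms(2) \<rho>(1), of "\<alpha> + of_nat m"] by (simp add: continuous_on)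
    then show ?thesis
      by (simp add: at_within_Icc_at_right)
  qed
  then have "((\<lambda>x. common_factor \<beta> \<rho> * reduced_gen_fun (\<alpha> + of_nat m) \<beta> x \<rho>) \<longlongrightarrow>
               common_factor \<beta> \<rho> * reduced_gen_fun (\<alpha> + of_nat m) \<beta> (-1) \<rho>) (at_right (-1))"
    by (intro tendsto_intros)
  moreover have "\<forall>\<^sub>F x in at_right (-1). common_factor \<beta> \<rho> * reduced_gen_fun (\<alpha> + of_nat m) \<beta> x \<rho> = gen_fun \<alpha> \<beta> m \<rho> x"
  proof -
    have "\<forall>\<^sub>F x in at_right (-1). x \<in> {-1<..<1 :: real}"
      by (intro eventually_at_right_real) auto
    then show ?thesis
      by eventually_elim (use gen_fun_conv_reduced[OF _ \<rho> assms(2)] in auto)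
  qed
  ultimately have "(gen_fun \<alpha> \<beta> m \<rho> \<longlongrightarrow> common_factor \<beta> \<rho> * reduced_gen_fun (\<alpha> + of_nat m) \<beta> (-1) \<rho>) (at_right (-1))"
    by (rule Lim_transform_eventually)
  then show ?thesis
    using sums gen_fun_conv_reduced[OF _ \<rho> assms(2), of x \<alpha> m] assms(4) by auto
qed

end
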